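(* The flag manifold $M=SU(3)/T_{max}$ does not admit invariant strictly $G_1f$-structures. That is, if $f$ is an $SU(3)$-invariant $f$-structure on $M$ and $g$ is an $SU(3)$-invariant Riemannian metric on $M$ such that $f$ is a $G_1f$-structure with respect to $g$, then $f$ is a nearly Kähler $f$-structure or a Hermitian $f$-structure with respect to $g$. In particular, there are no invariant strictly $G_1$-structures on $M$, i.e. no invariant almost Hermitian structures $(g,J)$ on $M$ of class $G_1$ that are neither nearly Kähler nor Hermitian.
   Context: Here $T_{max}\subset SU(3)$ is the subgroup of diagonal matrices. An $f$-structure on a manifold is a $(1,1)$-tensor field $f$ with $f^3+f=0$. It is a metric $f$-structure with respect to a Riemannian metric $g$ if $g(fX,Y)+g(X,fY)=0$ for all vector fields $X,Y$. On $M=SU(3)/T_{max}$ every $SU(3)$-invariant $f$-structure is a metric $f$-structure with respect to every $SU(3)$-invariant Riemannian metric. Let $\nabla$ be the Levi-Civita connection of $g$ and $\nabla_X(f)Y=\nabla_X(fY)-f\nabla_XY$. The composition tensor of a metric $f$-structure is $$T(X,Y)=\tfrac14 f\big(\nabla_{fX}(f)fY-\nabla_{f^2X}(f)f^2Y\big).$$ A metric $f$-structure $f$ on $(M,g)$ is called: a $G_1f$-structure if $T(X,X)=0$ for all vector fields $X$; a Hermitian $f$-structure ($Hf$-structure) if $T(X,Y)=0$ for all $X,Y$; a nearly Kähler $f$-structure ($NKf$-structure) if $\nabla_{fX}(f)fX=0$ for all $X$. A strictly $G_1f$-structure is a $G_1f$-structure that is neither an $NKf$-structure nor an $Hf$-structure.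 For an almost Hermitian structure $(g,J)$ (the case $f=J$, $J^2=-\mathrm{id}$): it is of class $G_1$ if $\nabla_X(J)X-\nabla_{JX}(J)JX=0$ for all $X$; Hermitian if $\nabla_X(J)Y-\nabla_{JX}(J)JY=0$ for all $X,Y$; nearly Kähler if $\nabla_X(J)X=0$ for all $X$. These are the specializations to $f=J$ of the classes above. *)

theory Defs
  imports "HOL-Analysis.Analysis"
begin

primrec Ck_on :: "nat \<Rightarrow> ('a::real_normed_vector \<Rightarrow> 'b::real_normed_vector) \<Rightarrow> 'a set \<Rightarrow> bool" where
  "Ck_on 0 F U \<longleftrightarrow> continuous_on U F"
| "Ck_on (Suc k) F U \<longleftrightarrow> (\<forall>x\<in>U. F differentiable (at x)) \<and>
     (\<forall>v. Ck_on k (\<lambda>x. frechet_derivative F (at x) v) U)"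

text \<open>Smoothness on an arbitrary subset of a normed space: near every point of the subset the map
  is the restriction of a smooth map of an open set. On an embedded submanifold this is the usual
  notion.\<close>

definition smooth_on :: "'a::real_normed_vector set \<Rightarrow> ('a \<Rightarrow> 'b::real_normed_vector) \<Rightarrow> bool" where
  "smooth_on S h \<longleftrightarrow> (\<forall>x\<in>S. \<exists>U F. open U \<and> x \<in> U \<and> (\<forall>k. Ck_on k F U) \<and> (\<forall>y\<in>U \<inter> S. F y = h y))"

type_synonym cmat3 = "complex^3^3"

definition ctranspose :: "cmat3 \<Rightarrow> cmat3" where
  "ctranspose A = (\<chi> i j. cnj (A $ j $ i))"

definition SU3 :: "cmat3 set" where
  "SU3 = {A. ctranspose A ** A = mat 1 \<and> det A = 1}"

definition T_max :: "cmat3 set" where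
  "T_max = {A \<in> SU3. \<forall>i j. i \<noteq> j \<longrightarrow> A $ i $ j = 0}"

lemma mat_1_in_SU3: "mat 1 \<in> SU3"
  by (simp add: SU3_def) (simp add: ctranspose_def mat_def vec_eq_iff)

typedef flag = "{(\<lambda>t. x ** t) ` T_max | x. x \<in> SU3}"
  using mat_1_in_SU3 by blast

definition proj :: "cmat3 \<Rightarrow> flag" where
  "proj x = Abs_flag ((\<lambda>t. x ** t) ` T_max)"

definition act :: "cmat3 \<Rightarrow> flag \<Rightarrow> flag" where
  "act a p = Abs_flag ((\<lambda>y. a ** y) ` Rep_flag p)"

text \<open>The quotient smooth structure: \<open>proj\<close> is a surjective submersion, so a function on the
  quotient is smooth iff its pullback to the group is.\<close>

definition smooth_fun :: "(flag \<Rightarrow> real) \<Rightarrow> bool" where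
  "smooth_fun \<phi> \<longleftrightarrow> smooth_on SU3 (\<lambda>x. \<phi> (proj x))"

text \<open>A tangent vector is a functional on smooth functions, namely the directional derivative along
  a smooth curve. By convention it is \<open>0\<close> on non-smooth functions, so that equality of tangent
  vectors is equality of functions. Only curves that lift to the group are used; this is
  no restriction because \<open>proj\<close> has smooth local sections.\<close>

type_synonym tvec = "(flag \<Rightarrow> real) \<Rightarrow> real"
type_synonym vfield = "flag \<Rightarrow> tvec"

definition velocity :: "(real \<Rightarrow> flag) \<Rightarrow> tvec" where
  "velocity c = (\<lambda>\<phi>. if smooth_fun \<phi> then deriv (\<lambda>t. \<phi> (c t)) 0 else 0)"

definition tangent_space :: "flag \<Rightarrow> tvec set" where
  "tangent_space p = {velocity (\<lambda>t. proj (\<gamma> t)) | \<gamma>.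
     smooth_on UNIV \<gamma> \<and> (\<forall>t. \<gamma> t \<in> SU3) \<and> proj (\<gamma> 0) = p}"

definition tv_zero :: tvec where
  "tv_zero = (\<lambda>\<phi>. 0)"

definition tv_add :: "tvec \<Rightarrow> tvec \<Rightarrow> tvec" where
  "tv_add v w = (\<lambda>\<phi>. v \<phi> + w \<phi>)"

definition tv_scale :: "real \<Rightarrow> tvec \<Rightarrow> tvec" where
  "tv_scale c v = (\<lambda>\<phi>. c * v \<phi>)"

definition tv_diff :: "tvec \<Rightarrow> tvec \<Rightarrow> tvec" where
  "tv_diff v w = (\<lambda>\<phi>. v \<phi> - w \<phi>)"

definition vf_zero :: vfield where
  "vf_zero = (\<lambda>p. tv_zero)"

definition vf_add :: "vfield \<Rightarrow> vfield \<Rightarrow> vfield" where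
  "vf_add X Y = (\<lambda>p. tv_add (X p) (Y p))"

definition vf_diff :: "vfield \<Rightarrow> vfield \<Rightarrow> vfield" where
  "vf_diff X Y = (\<lambda>p. tv_diff (X p) (Y p))"

definition vf_scale :: "(flag \<Rightarrow> real) \<Rightarrow> vfield \<Rightarrow> vfield" where
  "vf_scale \<phi> X = (\<lambda>p. tv_scale (\<phi> p) (X p))"

definition lie_derivative :: "vfield \<Rightarrow> (flag \<Rightarrow> real) \<Rightarrow> (flag \<Rightarrow> real)" where
  "lie_derivative X \<phi> = (\<lambda>p. X p \<phi>)"

definition vector_fields :: "vfield set" where
  "vector_fields = {X. (\<forall>p. X p \<in> tangent_space p) \<and>
     (\<forall>\<phi>. smooth_fun \<phi> \<longrightarrow> smooth_fun (lie_derivative X \<phi>))}"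

definition lie_bracket :: "vfield \<Rightarrow> vfield \<Rightarrow> vfield" where
  "lie_bracket X Y = (\<lambda>p \<phi>. X p (lie_derivative Y \<phi>) - Y p (lie_derivative X \<phi>))"

definition push :: "cmat3 \<Rightarrow> tvec \<Rightarrow> tvec" where
  "push a v = (\<lambda>\<phi>. v (\<lambda>p. \<phi> (act a p)))"

type_synonym tensor11 = "flag \<Rightarrow> tvec \<Rightarrow> tvec"
type_synonym metric = "flag \<Rightarrow> tvec \<Rightarrow> tvec \<Rightarrow> real"
type_synonym connection = "vfield \<Rightarrow> vfield \<Rightarrow> vfield"

definition app :: "tensor11 \<Rightarrow> vfield \<Rightarrow> vfield" where
  "app f X = (\<lambda>p. f p (X p))"

definition tensor_field_11 :: "tensor11 \<Rightarrow> bool" where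
  "tensor_field_11 f \<longleftrightarrow>
     (\<forall>p. \<forall>v\<in>tangent_space p. f p v \<in> tangent_space p) \<and>
     (\<forall>p. \<forall>v\<in>tangent_space p. \<forall>w\<in>tangent_space p. f p (tv_add v w) = tv_add (f p v) (f p w)) \<and>
     (\<forall>p c. \<forall>v\<in>tangent_space p. f p (tv_scale c v) = tv_scale c (f p v)) \<and>
     (\<forall>X\<in>vector_fields. app f X \<in> vector_fields)"

definition riemannian_metric :: "metric \<Rightarrow> bool" where
  "riemannian_metric g \<longleftrightarrow>
     (\<forall>p. \<forall>u\<in>tangent_space p. \<forall>v\<in>tangent_space p. \<forall>w\<in>tangent_space p.
        g p (tv_add u v) w = g p u w + g p v w) \<and>
     (\<forall>p c. \<forall>v\<in>tangent_space p. \<forall>w\<in>tangent_space p. g p (tv_scale c v) w = c * g p v w) \<and>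
     (\<forall>p. \<forall>v\<in>tangent_space p. \<forall>w\<in>tangent_space p. g p v w = g p w v) \<and>
     (\<forall>p. \<forall>v\<in>tangent_space p. v \<noteq> tv_zero \<longrightarrow> 0 < g p v v) \<and>
     (\<forall>X\<in>vector_fields. \<forall>Y\<in>vector_fields. smooth_fun (\<lambda>p. g p (X p) (Y p)))"

definition invariant_tensor :: "tensor11 \<Rightarrow> bool" where
  "invariant_tensor f \<longleftrightarrow>
     (\<forall>a\<in>SU3. \<forall>p. \<forall>v\<in>tangent_space p. f (act a p) (push a v) = push a (f p v))"

definition invariant_metric :: "metric \<Rightarrow> bool" where
  "invariant_metric g \<longleftrightarrow>
     (\<forall>a\<in>SU3. \<forall>p. \<forall>v\<in>tangent_space p. \<forall>w\<in>tangent_space p.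
        g (act a p) (push a v) (push a w) = g p v w)"

definition affine_connection :: "connection \<Rightarrow> bool" where
  "affine_connection nabla \<longleftrightarrow>
     (\<forall>X\<in>vector_fields. \<forall>Y\<in>vector_fields. nabla X Y \<in> vector_fields) \<and>
     (\<forall>X\<in>vector_fields. \<forall>Y\<in>vector_fields. \<forall>Z\<in>vector_fields.
        nabla (vf_add X Y) Z = vf_add (nabla X Z) (nabla Y Z) \<and>
        nabla X (vf_add Y Z) = vf_add (nabla X Y) (nabla X Z)) \<and>
     (\<forall>\<phi>. \<forall>X\<in>vector_fields. \<forall>Y\<in>vector_fields. smooth_fun \<phi> \<longrightarrow>
        nabla (vf_scale \<phi> X) Y = vf_scale \<phi> (nabla X Y) \<and>
        nabla X (vf_scale \<phi> Y) = vf_add (vf_scale (lie_derivative X \<phi>) Y) (vf_scale \<phi> (nabla X Y)))"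

definition levi_civita :: "metric \<Rightarrow> connection \<Rightarrow> bool" where
  "levi_civita g nabla \<longleftrightarrow> affine_connection nabla \<and>
     (\<forall>X\<in>vector_fields. \<forall>Y\<in>vector_fields. vf_diff (nabla X Y) (nabla Y X) = lie_bracket X Y) \<and>
     (\<forall>X\<in>vector_fields. \<forall>Y\<in>vector_fields. \<forall>Z\<in>vector_fields. \<forall>p.
        lie_derivative X (\<lambda>q. g q (Y q) (Z q)) p =
          g p (nabla X Y p) (Z p) + g p (Y p) (nabla X Z p))"

text \<open>In the notation of the literature \<open>cov nabla f X Y\<close> is \<open>\<nabla>\<^sub>X(f)Y\<close>.\<close>

definition cov :: "connection \<Rightarrow> tensor11 \<Rightarrow> vfield \<Rightarrow> vfield \<Rightarrow> vfield" where
  "cov nabla f X Y = vf_diff (nabla X (app f Y)) (app f (nabla X Y))"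

definition f_structure :: "tensor11 \<Rightarrow> bool" where
  "f_structure f \<longleftrightarrow> tensor_field_11 f \<and>
     (\<forall>p. \<forall>v\<in>tangent_space p. tv_add (f p (f p (f p v))) (f p v) = tv_zero)"

definition metric_f_structure :: "metric \<Rightarrow> tensor11 \<Rightarrow> bool" where
  "metric_f_structure g f \<longleftrightarrow> riemannian_metric g \<and> f_structure f \<and>
     (\<forall>p. \<forall>v\<in>tangent_space p. \<forall>w\<in>tangent_space p. g p (f p v) w + g p v (f p w) = 0)"

definition composition_tensor :: "connection \<Rightarrow> tensor11 \<Rightarrow> vfield \<Rightarrow> vfield \<Rightarrow> vfield" where
  "composition_tensor nabla f X Y = vf_scale (\<lambda>p. 1/4)
     (app f (vf_diff (cov nabla f (app f X) (app f Y))
                     (cov nabla f (app f (app f X)) (app f (app f Y)))))"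

text \<open>In the following predicates \<open>nabla\<close> is meant to be the Levi-Civita connection of \<open>g\<close>; it
  is an argument, tied to \<open>g\<close> by \<open>levi_civita\<close>, which determines it on \<open>vector_fields\<close>.\<close>

definition G1f_structure :: "metric \<Rightarrow> connection \<Rightarrow> tensor11 \<Rightarrow> bool" where
  "G1f_structure g nabla f \<longleftrightarrow> metric_f_structure g f \<and>
     (\<forall>X\<in>vector_fields. composition_tensor nabla f X X = vf_zero)"

definition Hf_structure :: "metric \<Rightarrow> connection \<Rightarrow> tensor11 \<Rightarrow> bool" where
  "Hf_structure g nabla f \<longleftrightarrow> metric_f_structure g f \<and>
     (\<forall>X\<in>vector_fields. \<forall>Y\<in>vector_fields. composition_tensor nabla f X Y = vf_zero)"

definition NKf_structure :: "metric \<Rightarrow> connection \<Rightarrow> tensor11 \<Rightarrow> bool" where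
  "NKf_structure g nabla f \<longleftrightarrow> metric_f_structure g f \<and>
     (\<forall>X\<in>vector_fields. cov nabla f (app f X) (app f X) = vf_zero)"

definition strictly_G1f_structure :: "metric \<Rightarrow> connection \<Rightarrow> tensor11 \<Rightarrow> bool" where
  "strictly_G1f_structure g nabla f \<longleftrightarrow>
     G1f_structure g nabla f \<and> \<not> NKf_structure g nabla f \<and> \<not> Hf_structure g nabla f"

definition almost_hermitian :: "metric \<Rightarrow> tensor11 \<Rightarrow> bool" where
  "almost_hermitian g J \<longleftrightarrow> riemannian_metric g \<and> tensor_field_11 J \<and>
     (\<forall>p. \<forall>v\<in>tangent_space p. J p (J p v) = tv_scale (-1) v) \<and>
     (\<forall>p. \<forall>v\<in>tangent_space p. \<forall>w\<in>tangent_space p. g p (J p v) (J p w) = g p v w)"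

definition class_G1 :: "metric \<Rightarrow> connection \<Rightarrow> tensor11 \<Rightarrow> bool" where
  "class_G1 g nabla J \<longleftrightarrow> almost_hermitian g J \<and>
     (\<forall>X\<in>vector_fields. vf_diff (cov nabla J X X) (cov nabla J (app J X) (app J X)) = vf_zero)"

definition hermitian :: "metric \<Rightarrow> connection \<Rightarrow> tensor11 \<Rightarrow> bool" where
  "hermitian g nabla J \<longleftrightarrow> almost_hermitian g J \<and>
     (\<forall>X\<in>vector_fields. \<forall>Y\<in>vector_fields.
        vf_diff (cov nabla J X Y) (cov nabla J (app J X) (app J Y)) = vf_zero)"

definition nearly_kaehler :: "metric \<Rightarrow> connection \<Rightarrow> tensor11 \<Rightarrow> bool" where
  "nearly_kaehler g nabla J \<longleftrightarrow> almost_hermitian g J \<and>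
     (\<forall>X\<in>vector_fields. cov nabla J X X = vf_zero)"

definition strictly_G1 :: "metric \<Rightarrow> connection \<Rightarrow> tensor11 \<Rightarrow> bool" where
  "strictly_G1 g nabla J \<longleftrightarrow>
     class_G1 g nabla J \<and> \<not> nearly_kaehler g nabla J \<and> \<not> hermitian g nabla J"

end

theory Submission
  imports Defs
begin

text \<open>A vector field \<open>X\<close> on the flag manifold is the same as a function from \<open>SU(3)\<close> to the
  space \<open>m\<close> of skew-Hermitian matrices with zero diagonal, equivariant under the torus. In this global
  frame, invariant tensors have constant coefficients, so that \<open>\<nabla>\<^sub>X Y\<close> is the derivative of \<open>Y\<close> along
  \<open>X\<close> plus a bilinear map of \<open>m\<close> given by the Koszul formula, and \<open>\<nabla>\<^sub>X(f)Y\<close> is pointwise in \<open>X\<close>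
  and \<open>Y\<close>; neither cut-off functions nor tensoriality arguments are needed.
  Since \<open>m\<close> splits into three inequivalent planes (the root spaces), \<open>f\<close> acts on the
  planes by scalars \<open>\<mu>\<^sub>1, \<mu>\<^sub>2, \<mu>\<^sub>3\<close> in \<open>{0, \<i>, -\<i>}\<close> and the metric is given by
  three positive weights. Unless the scalars are equal and nonzero, the composition tensor vanishes
  for every choice of weights. If they are equal and nonzero, \<open>T(X,X) = 0\<close> at the vector with
  coordinates \<open>(1,1,1)\<close> forces the symmetric part of the Koszul map to vanish, which is the
  nearly Kaehler condition.\<close>

section \<open>Closure properties of smooth maps\<close>

text \<open>Tangent vectors are functionals, so frame coordinates have to be recovered by testing on
  enough smooth functions. The rank-one projections onto the column lines serve for this: their
  derivatives are commutators with the frame coordinates, and the bracket of fields reduces to the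
  Jacobi identity. The case split comes from a conjugation. With coordinates taken from the entries
  (1,2), (2,3), (3,1), the bracket of two root planes lies in the third and is the conjugate of a
  product. An imaginary scalar changes sign when moved across a conjugation, so \<nabla>(f) contains
  sums such as \<mu>1 + \<mu>3 where a commutator suggests differences, and the composition tensor
  has a further factor such as 1 - \<mu>2 \<mu>3. For scalars \<i> and -\<i>, that factor is zero if
  \<mu>2 = -\<mu>3, and the sums are zero if \<mu>2 = \<mu>3 = -\<mu>1. On equal arguments the
  Koszul map has the coefficients (l2 - l3)/l1 and cyclic shifts, so its symmetric part vanishes
  exactly when the three weights are equal.\<close>

declare Ck_on.simps(2) [simp del]

lemma Ck_on_SucD: "Ck_on (Suc k) F U \<Longrightarrow> Ck_on k F U"
proof (induction k arbitrary: F)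
  case 0
  then show ?case
    by (simp add: Ck_on.simps(2) continuous_at_imp_continuous_on differentiable_imp_continuous_within)
next
  case (Suc k)
  from Suc.prems have "\<forall>v. Ck_on (Suc k) (\<lambda>x. frechet_derivative F (at x) v) U"
    "\<forall>x\<in>U. F differentiable (at x)"
    unfolding Ck_on.simps(2) [of "Suc k"] by simp_all
  with Suc.IH show ?case
    by (subst Ck_on.simps(2)) simp
qed

lemma frechet_derivative_eqI: "(F has_derivative F') (at x) \<Longrightarrow> frechet_derivative F (at x) = F'"
  by (rule frechet_derivative_at [symmetric])

lemma Ck_on_has_derivative:
  assumes "Ck_on (Suc k) F U" "x \<in> U"
  shows "(F has_derivative frechet_derivative F (at x)) (at x)"
  using assms unfolding Ck_on.simps(2) frechet_derivative_works [symmetric] by simp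

lemma Ck_on_cong:
  assumes "open U" "Ck_on k F U" "\<And>x. x \<in> U \<Longrightarrow> F x = G x"
  shows "Ck_on k G U"
  using assms(2,3)
proof (induction k arbitrary: F G)
  case 0
  then show ?case using continuous_on_cong by force
next
  case (Suc k)
  have G: "(G has_derivative frechet_derivative F (at x)) (at x)" if "x \<in> U" for x
    by (rule has_derivative_transform_within_open
          [OF Ck_on_has_derivative [OF Suc.prems(1) that] \<open>open U\<close> that])
      (rule Suc.prems(2))
  have "Ck_on k (\<lambda>x. frechet_derivative G (at x) v) U" for v
    by (rule Suc.IH [of "\<lambda>x. frechet_derivative F (at x) v"])
      (use Suc.prems in \<open>simp_all add: Ck_on.simps(2) frechet_derivative_eqI [OF G]\<close>)
  then show ?case
    using G unfolding Ck_on.simps(2) differentiable_def by blast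
qed

text \<open>Replaces the choice-based \<open>frechet_derivative\<close> by any explicit derivative;
  the two agree on the open set by uniqueness, so the closure lemmas below can state their
  derivatives by formula.\<close>

lemma Ck_on_SucI:
  assumes "open U" "\<And>x. x \<in> U \<Longrightarrow> (F has_derivative F' x) (at x)" "\<And>v. Ck_on k (\<lambda>x. F' x v) U"
  shows "Ck_on (Suc k) F U"
proof -
  have "Ck_on k (\<lambda>x. frechet_derivative F (at x) v) U" for v
    by (rule Ck_on_cong [OF assms(1) assms(3)]) (simp add: frechet_derivative_eqI [OF assms(2)])
  then show ?thesis
    using assms(2) unfolding Ck_on.simps(2) differentiable_def by blast
qed

lemma Ck_on_frechet_derivative:
  "Ck_on (Suc k) F U \<Longrightarrow> Ck_on k (\<lambda>x. frechet_derivative F (at x) v) U"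
  unfolding Ck_on.simps(2) by simp

lemma Ck_on_const: "open U \<Longrightarrow> Ck_on k (\<lambda>x. c) U"
proof (induction k arbitrary: c)
  case (Suc k)
  show ?case
    by (rule Ck_on_SucI [OF \<open>open U\<close>, where F' = "\<lambda>x v. 0"]) (simp_all add: Suc)
qed simp

lemma Ck_on_bounded_linear:
  assumes "bounded_linear L" "open U"
  shows "Ck_on k L U"
proof (cases k)
  case 0
  then show ?thesis by (simp add: linear_continuous_on [OF assms(1)])
next
  case (Suc n)
  show ?thesis unfolding Suc
    by (rule Ck_on_SucI [OF \<open>open U\<close>, where F' = "\<lambda>x. L"])
      (intro bounded_linear_imp_has_derivative Ck_on_const assms)+
qed

lemma Ck_on_add:
  assumes "open U" "Ck_on k F U" "Ck_on k G U"
  shows "Ck_on k (\<lambda>x. F x + G x) U"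
  using assms(2,3)
proof (induction k arbitrary: F G)
  case 0
  then show ?case by (simp add: continuous_on_add)
next
  case (Suc k)
  note F' = Ck_on_has_derivative [OF Suc.prems(1)] Ck_on_frechet_derivative [OF Suc.prems(1)]
  note G' = Ck_on_has_derivative [OF Suc.prems(2)] Ck_on_frechet_derivative [OF Suc.prems(2)]
  show ?case
    by (rule Ck_on_SucI [OF \<open>open U\<close>, where F' = "\<lambda>x v. frechet_derivative F (at x) v + frechet_derivative G (at x) v"])
      (intro has_derivative_add Suc.IH F' G' \<open>open U\<close>; assumption)+
qed

lemma Ck_on_sum:
  assumes "open U" "\<And>i. i \<in> I \<Longrightarrow> Ck_on k (F i) U"
  shows "Ck_on k (\<lambda>x. \<Sum>i\<in>I. F i x) U"
  using assms(2)
proof (induction I rule: infinite_finite_induct)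
  case (insert i I)
  then show ?case
    unfolding sum.insert [OF insert.hyps] by (intro Ck_on_add assms(1)) simp_all
qed (auto intro: Ck_on_const assms)

lemma Ck_on_bilinear:
  assumes "bounded_bilinear B" "open U" "Ck_on k F U" "Ck_on k G U"
  shows "Ck_on k (\<lambda>x. B (F x) (G x)) U"
  using assms(3,4)
proof (induction k arbitrary: F G)
  case 0
  then show ?case by (auto intro: bounded_bilinear.continuous_on [OF assms(1)])
next
  case (Suc k)
  note F' = Ck_on_has_derivative [OF Suc.prems(1)] Ck_on_frechet_derivative [OF Suc.prems(1)]
  note G' = Ck_on_has_derivative [OF Suc.prems(2)] Ck_on_frechet_derivative [OF Suc.prems(2)]
  show ?case
  proof (rule Ck_on_SucI [OF \<open>open U\<close>, where F' = "\<lambda>x v. B (F x) (frechet_derivative G (at x) v) + B (frechet_derivative F (at x) v) (G x)"])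
    show "((\<lambda>x. B (F x) (G x)) has_derivative (\<lambda>v. B (F x) (frechet_derivative G (at x) v) + B (frechet_derivative F (at x) v) (G x))) (at x)"
      if "x \<in> U" for x
      by (rule bounded_bilinear.FDERIV [OF assms(1) F'(1) [OF that] G'(1) [OF that]])
    \<comment> \<open>The product rule leaves one factor undifferentiated; it is of order
      \<open>Suc k\<close> and is lowered to \<open>k\<close> so that the induction hypothesis
      applies.\<close>
    show "Ck_on k (\<lambda>x. B (F x) (frechet_derivative G (at x) v) + B (frechet_derivative F (at x) v) (G x)) U" for v
      by (intro Ck_on_add \<open>open U\<close> Suc.IH F'(2) G'(2) Ck_on_SucD [OF Suc.prems(1)] Ck_on_SucD [OF Suc.prems(2)])
  qed
qed

lemma Ck_on_linear_comp:
  assumes "bounded_linear L" "open U" "Ck_on k F U"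
  shows "Ck_on k (\<lambda>x. L (F x)) U"
  using assms(3)
proof (induction k arbitrary: F)
  case 0
  then show ?case by (auto intro: bounded_linear.continuous_on [OF assms(1)])
next
  case (Suc k)
  note F' = Ck_on_has_derivative [OF Suc.prems] Ck_on_frechet_derivative [OF Suc.prems]
  show ?case
    by (rule Ck_on_SucI [OF \<open>open U\<close>, where F' = "\<lambda>x v. L (frechet_derivative F (at x) v)"])
      (intro bounded_linear.has_derivative [OF assms(1)] Suc.IH F'; assumption)+
qed

text \<open>For a linear inner map the chain rule keeps the direction fixed: differentiating in
  direction \<open>v\<close> gives the derivative of \<open>F\<close> in the constant direction
  \<open>L v\<close>, composed with \<open>L\<close> again.\<close>

lemma Ck_on_comp_linear:
  assumes "bounded_linear L" "open U" "Ck_on k F U"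
  shows "Ck_on k (\<lambda>x. F (L x)) (L -` U)"
  using assms(3)
proof (induction k arbitrary: F)
  case 0
  then show ?case
    by (simp add: continuous_on_compose2 [where g = F] linear_continuous_on assms(1))
next
  case (Suc k)
  note F' = Ck_on_has_derivative [OF Suc.prems] Ck_on_frechet_derivative [OF Suc.prems]
  have op: "open (L -` U)"
    by (rule continuous_open_vimage [OF \<open>open U\<close>])
      (simp add: assms(1) linear_continuous_at)
  show ?case
  proof (rule Ck_on_SucI [OF op, where F' = "\<lambda>x v. frechet_derivative F (at (L x)) (L v)"])
    show "((\<lambda>x. F (L x)) has_derivative (\<lambda>v. frechet_derivative F (at (L x)) (L v))) (at x)" if "x \<in> L -` U" for x
      using diff_chain_at [OF bounded_linear_imp_has_derivative [OF assms(1)] F'(1), of x] that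
      by (simp add: o_def)
    show "Ck_on k (\<lambda>x. frechet_derivative F (at (L x)) (L v)) (L -` U)" for v
      using Suc.IH [OF F'(2)] .
  qed
qed

section \<open>Smooth maps on subsets and along curves\<close>

lemma smooth_onI:
  assumes "open U" "S \<subseteq> U" "\<And>k. Ck_on k F U"
  shows "smooth_on S F"
  unfolding smooth_on_def
  using assms by (intro ballI exI [of _ U] exI [of _ F] conjI allI) auto

lemma smooth_onE:
  assumes "smooth_on S F" "x \<in> S"
  obtains U G where "open U" "x \<in> U" "\<forall>k. Ck_on k G U" "\<forall>y\<in>U \<inter> S. G y = F y"
  using bspec [OF assms(1) [unfolded smooth_on_def] assms(2)] by (elim exE conjE)

lemma smooth_on_cong:
  assumes "smooth_on S F" "\<And>x. x \<in> S \<Longrightarrow> F x = G x"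
  shows "smooth_on S G"
  using assms unfolding smooth_on_def by (metis (no_types, lifting) IntD2)

lemma smooth_on_linear_comp:
  assumes "bounded_linear L" "smooth_on S F"
  shows "smooth_on S (\<lambda>x. L (F x))"
  unfolding smooth_on_def
proof
  fix x assume "x \<in> S"
  obtain U G where *: "open U" "x \<in> U" "\<forall>k. Ck_on k G U" "\<forall>y\<in>U \<inter> S. G y = F y"
    by (rule smooth_onE [OF assms(2) \<open>x \<in> S\<close>])
  have "\<forall>k. Ck_on k (\<lambda>y. L (G y)) U"
    by (intro allI Ck_on_linear_comp [OF assms(1) *(1)] spec [OF *(3)])
  then show "\<exists>U G. open U \<and> x \<in> U \<and> (\<forall>k. Ck_on k G U) \<and> (\<forall>y\<in>U \<inter> S. G y = L (F y))"
    using *(1,2,4) by (intro exI [of _ U] exI [of _ "\<lambda>y. L (G y)"] conjI) simp_all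
qed

lemma smooth_on_comp_linear:
  assumes "bounded_linear L" "smooth_on S F" "\<And>x. x \<in> S \<Longrightarrow> L x \<in> S"
  shows "smooth_on S (\<lambda>x. F (L x))"
  unfolding smooth_on_def
proof
  fix x assume "x \<in> S"
  obtain U G where *: "open U" "L x \<in> U" "\<forall>k. Ck_on k G U" "\<forall>y\<in>U \<inter> S. G y = F y"
    by (rule smooth_onE [OF assms(2) assms(3) [OF \<open>x \<in> S\<close>]])
  have op: "open (L -` U)"
    by (rule continuous_open_vimage [OF *(1)]) (simp add: assms(1) linear_continuous_at)
  have "\<forall>k. Ck_on k (\<lambda>y. G (L y)) (L -` U)"
    by (intro allI Ck_on_comp_linear [OF assms(1) *(1)] spec [OF *(3)])
  then show "\<exists>U G. open U \<and> x \<in> U \<and> (\<forall>k. Ck_on k G U) \<and> (\<forall>y\<in>U \<inter> S. G y = F (L y))"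
    using op *(2,4) assms(3)
    by (intro exI [of _ "L -` U"] exI [of _ "\<lambda>y. G (L y)"] conjI) simp_all
qed

lemma smooth_on_has_derivative:
  assumes "smooth_on UNIV F"
  obtains F' where "(F has_derivative F') (at x)"
proof -
  obtain U G where *: "open U" "x \<in> U" "\<forall>k. Ck_on k G U" "\<forall>y\<in>U \<inter> UNIV. G y = F y"
    by (rule smooth_onE [OF assms UNIV_I])
  have "(F has_derivative frechet_derivative G (at x)) (at x)"
    by (rule has_derivative_transform_within_open
          [OF Ck_on_has_derivative [OF spec [OF *(3), of "Suc 0"] *(2)] *(1,2)])
      (simp add: *(4))
  then show thesis by (rule that)
qed

lemma smooth_curve_has_vector_derivative:
  assumes "smooth_on UNIV \<gamma>"
  obtains D where "(\<gamma> has_vector_derivative D) (at t)"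
  using smooth_on_has_derivative [OF assms, of t]
  by (metis differentiableI vector_derivative_works)

text \<open>\<open>Ck_on\<close> controls derivatives in constant directions. A direction that moves
  linearly with the point is expanded in the finite basis, which gives a sum of linear coefficients
  times derivatives in constant directions.\<close>

lemma Ck_on_directional:
  fixes F :: "'a::euclidean_space \<Rightarrow> 'b::real_normed_vector"
  assumes "open U" "\<And>k. Ck_on k F U" "bounded_linear L"
  shows "Ck_on k (\<lambda>x. frechet_derivative F (at x) (L x)) U"
proof -
  have lin: "linear (frechet_derivative F (at x))" if "x \<in> U" for x
    by (rule has_derivative_linear [OF Ck_on_has_derivative [OF assms(2) [of "Suc 0"] that]])
  have "Ck_on k (\<lambda>x. \<Sum>b\<in>Basis. (L x \<bullet> b) *\<^sub>R frechet_derivative F (at x) b) U"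
  proof (intro Ck_on_sum Ck_on_bilinear [OF bounded_bilinear_scaleR] \<open>open U\<close>)
    show "Ck_on k (\<lambda>x. L x \<bullet> b) U" for b
      by (rule Ck_on_bounded_linear [OF _ \<open>open U\<close>])
        (rule bounded_linear_compose [OF bounded_linear_inner_left assms(3)])
    show "Ck_on k (\<lambda>x. frechet_derivative F (at x) b) U" for b
      using assms(2) [of "Suc k"] by (simp add: Ck_on.simps(2))
  qed
  then show ?thesis
  proof (rule Ck_on_cong [OF assms(1)])
    fix x assume "x \<in> U"
    interpret linear "frechet_derivative F (at x)" using lin \<open>x \<in> U\<close> .
    show "(\<Sum>b\<in>Basis. (L x \<bullet> b) *\<^sub>R frechet_derivative F (at x) b) = frechet_derivative F (at x) (L x)"
      by (metis (no_types, lifting) euclidean_representation scale sum sum.cong)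
  qed
qed

text \<open>The family is closed under differentiation, up to a scalar factor: the derivative has
  constant term zero and the two other coefficients exchanged and rescaled. Hence the induction
  generalizes over the coefficients.\<close>

lemma Ck_on_trig:
  fixes a b c :: "'a::real_normed_vector" and r :: real
  shows "Ck_on k (\<lambda>t. a + cos (r * t) *\<^sub>R b + sin (r * t) *\<^sub>R c) UNIV"
proof (induction k arbitrary: a b c)
  case 0
  show ?case by (auto intro!: continuous_intros)
next
  case (Suc k)
  have lin: "bounded_linear (\<lambda>x::'a. s *\<^sub>R x)" for s
    by (rule bounded_linear_scaleR_right)
  show ?case
  proof (rule Ck_on_SucI [OF open_UNIV, where F' = "\<lambda>t s. s *\<^sub>R (0 + cos (r * t) *\<^sub>R (r *\<^sub>R c) + sin (r * t) *\<^sub>R (- r *\<^sub>R b))"])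
    show "Ck_on k (\<lambda>t. s *\<^sub>R (0 + cos (r * t) *\<^sub>R (r *\<^sub>R c) + sin (r * t) *\<^sub>R (- r *\<^sub>R b))) UNIV" for s
      by (rule Ck_on_linear_comp [OF lin]) (auto simp only: open_UNIV Suc.IH)
  qed (auto intro!: derivative_eq_intros simp: algebra_simps)
qed

section \<open>The group and its quotient\<close>

lemma bounded_bilinear_matmul: "bounded_bilinear ((**) :: cmat3 \<Rightarrow> cmat3 \<Rightarrow> cmat3)"
proof -
  have "bilinear ((**) :: cmat3 \<Rightarrow> cmat3 \<Rightarrow> cmat3)"
    unfolding bilinear_def
    by (auto intro!: linearI simp: vec_eq_iff matrix_matrix_mult_def sum.distrib scaleR_sum_right
        algebra_simps)
  then show ?thesis by (simp add: bilinear_conv_bounded_bilinear)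
qed

lemmas matmul_add_left = bounded_bilinear.add_left [OF bounded_bilinear_matmul]
lemmas matmul_add_right = bounded_bilinear.add_right [OF bounded_bilinear_matmul]
lemmas matmul_diff_left = bounded_bilinear.diff_left [OF bounded_bilinear_matmul]
lemmas matmul_diff_right = bounded_bilinear.diff_right [OF bounded_bilinear_matmul]
lemmas matmul_minus_left = bounded_bilinear.minus_left [OF bounded_bilinear_matmul]
lemmas matmul_minus_right = bounded_bilinear.minus_right [OF bounded_bilinear_matmul]
lemmas matmul_scaleR_left = bounded_bilinear.scaleR_left [OF bounded_bilinear_matmul]
lemmas matmul_scaleR_right = bounded_bilinear.scaleR_right [OF bounded_bilinear_matmul]
lemmas matmul_zero_left = bounded_bilinear.zero_left [OF bounded_bilinear_matmul]
lemmas matmul_zero_right = bounded_bilinear.zero_right [OF bounded_bilinear_matmul]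
lemmas bounded_linear_matmul_left = bounded_bilinear.bounded_linear_left [OF bounded_bilinear_matmul]
lemmas bounded_linear_matmul_right = bounded_bilinear.bounded_linear_right [OF bounded_bilinear_matmul]
lemmas matmul_linear_simps = matmul_add_left matmul_add_right matmul_diff_left matmul_diff_right
  matmul_minus_left matmul_minus_right matmul_scaleR_left matmul_scaleR_right
  matmul_zero_left matmul_zero_right

lemma bounded_linear_ctranspose: "bounded_linear ctranspose"
  unfolding linear_conv_bounded_linear [symmetric]
  by (rule linearI) (simp_all add: vec_eq_iff ctranspose_def)

lemmas linear_ctranspose = bounded_linear.linear [OF bounded_linear_ctranspose]
lemmas ctranspose_linear_simps = linear_add [OF linear_ctranspose] linear_diff [OF linear_ctranspose]
  linear_scale [OF linear_ctranspose] linear_0 [OF linear_ctranspose] linear_neg [OF linear_ctranspose]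

lemma ctranspose_mult: "ctranspose (A ** B) = ctranspose B ** ctranspose A"
  by (simp add: vec_eq_iff ctranspose_def matrix_matrix_mult_def mult.commute)

lemma ctranspose_ctranspose [simp]: "ctranspose (ctranspose A) = A"
  by (simp add: vec_eq_iff ctranspose_def)

lemma ctranspose_mat_1 [simp]: "ctranspose (mat 1) = mat 1"
  by (simp add: vec_eq_iff ctranspose_def mat_def)

lemma det_ctranspose: "det (ctranspose A) = cnj (det A)"
  by (simp add: det_3 ctranspose_def algebra_simps)

definition mat3 :: "complex \<Rightarrow> complex \<Rightarrow> complex \<Rightarrow> complex \<Rightarrow> complex \<Rightarrow> complex
    \<Rightarrow> complex \<Rightarrow> complex \<Rightarrow> complex \<Rightarrow> cmat3" where
  "mat3 a b c d e f g h i = vector [vector [a, b, c], vector [d, e, f], vector [g, h, i]]"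

lemma mat3_nth [simp]:
  "mat3 a b c d e f g h i $ 1 $ 1 = a" "mat3 a b c d e f g h i $ 1 $ 2 = b"
  "mat3 a b c d e f g h i $ 1 $ 3 = c" "mat3 a b c d e f g h i $ 2 $ 1 = d"
  "mat3 a b c d e f g h i $ 2 $ 2 = e" "mat3 a b c d e f g h i $ 2 $ 3 = f"
  "mat3 a b c d e f g h i $ 3 $ 1 = g" "mat3 a b c d e f g h i $ 3 $ 2 = h"
  "mat3 a b c d e f g h i $ 3 $ 3 = i"
  by (simp_all add: mat3_def)

lemma cmat3_eq_iff:
  fixes A B :: cmat3
  shows "A = B \<longleftrightarrow> A$1$1 = B$1$1 \<and> A$1$2 = B$1$2 \<and> A$1$3 = B$1$3 \<and>
    A$2$1 = B$2$1 \<and> A$2$2 = B$2$2 \<and> A$2$3 = B$2$3 \<and>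
    A$3$1 = B$3$1 \<and> A$3$2 = B$3$2 \<and> A$3$3 = B$3$3"
  by (auto simp: vec_eq_iff forall_3)

lemma matmul_nth: "((A::cmat3) ** B) $ i $ j = A$i$1 * B$1$j + A$i$2 * B$2$j + A$i$3 * B$3$j"
  by (simp add: matrix_matrix_mult_def sum_3)

lemma ctranspose_nth [simp]: "ctranspose A $ i $ j = cnj (A $ j $ i)"
  by (simp add: ctranspose_def)

lemma mat_1_nth: "(mat 1 :: cmat3) $ i $ j = (if i = j then 1 else 0)"
  by (simp add: mat_def)

section \<open>The group, the torus and the cosets\<close>

lemma SU3_left_inverse: "x \<in> SU3 \<Longrightarrow> ctranspose x ** x = mat 1"
  by (simp add: SU3_def)

lemma SU3_right_inverse: "x \<in> SU3 \<Longrightarrow> x ** ctranspose x = mat 1"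
  by (simp add: SU3_def matrix_left_right_inverse)

lemma SU3_cancel:
  assumes "x \<in> SU3"
  shows "ctranspose x ** (x ** A) = A" "x ** (ctranspose x ** A) = A"
  by (simp_all add: matrix_mul_assoc SU3_left_inverse SU3_right_inverse assms)

lemma SU3_mult:
  assumes "x \<in> SU3" "y \<in> SU3"
  shows "x ** y \<in> SU3"
proof -
  have "ctranspose (x ** y) ** (x ** y) = ctranspose y ** (ctranspose x ** (x ** y))"
    by (simp add: ctranspose_mult matrix_mul_assoc)
  also have "\<dots> = mat 1"
    by (simp only: SU3_cancel assms SU3_left_inverse)
  finally show ?thesis
    using assms by (simp add: SU3_def det_mul)
qed

lemma SU3_ctranspose: "x \<in> SU3 \<Longrightarrow> ctranspose x \<in> SU3"
  using SU3_right_inverse [of x] by (simp add: SU3_def det_ctranspose)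

lemma T_max_subset: "t \<in> T_max \<Longrightarrow> t \<in> SU3"
  by (simp add: T_max_def)

lemma T_max_nth: "t \<in> T_max \<Longrightarrow> i \<noteq> j \<Longrightarrow> t $ i $ j = 0"
  by (simp add: T_max_def)

lemma mat_1_in_T_max: "mat 1 \<in> T_max"
  by (simp add: T_max_def mat_1_in_SU3 mat_1_nth)

lemma T_max_mult: "s \<in> T_max \<Longrightarrow> t \<in> T_max \<Longrightarrow> s ** t \<in> T_max"
  unfolding T_max_def
  by (simp add: SU3_mult) (simp add: matrix_matrix_mult_def, metis (no_types, lifting) mult_eq_0_iff sum.neutral)

lemma T_max_ctranspose: "t \<in> T_max \<Longrightarrow> ctranspose t \<in> T_max"
  by (auto simp: T_max_def SU3_ctranspose)

lemma Rep_flag_proj: "x \<in> SU3 \<Longrightarrow> Rep_flag (proj x) = (\<lambda>t. x ** t) ` T_max"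
  unfolding proj_def by (rule Abs_flag_inverse) blast

lemma proj_eq_iff:
  assumes "x \<in> SU3" "y \<in> SU3"
  shows "proj x = proj y \<longleftrightarrow> (\<exists>t\<in>T_max. y = x ** t)"
proof
  assume "proj x = proj y"
  then have "(\<lambda>t. x ** t) ` T_max = (\<lambda>t. y ** t) ` T_max"
    using Rep_flag_proj assms by metis
  moreover have "y \<in> (\<lambda>t. y ** t) ` T_max"
    using mat_1_in_T_max by (metis image_eqI matrix_mul_rid)
  ultimately show "\<exists>t\<in>T_max. y = x ** t" by blast
next
  assume "\<exists>t\<in>T_max. y = x ** t"
  then obtain t where t: "t \<in> T_max" "y = x ** t" by blast
  have "(\<lambda>s. x ** s) ` T_max = (\<lambda>s. y ** s) ` T_max"
  proof (intro set_eqI iffI)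
    fix z assume "z \<in> (\<lambda>s. x ** s) ` T_max"
    then obtain s where "s \<in> T_max" "z = x ** s" by blast
    then have "z = y ** (ctranspose t ** s)" "ctranspose t ** s \<in> T_max"
      using t T_max_ctranspose T_max_mult T_max_subset [OF t(1)]
      by (simp_all add: matrix_mul_assoc [symmetric] SU3_cancel)
    then show "z \<in> (\<lambda>s. y ** s) ` T_max" by blast
  next
    fix z assume "z \<in> (\<lambda>s. y ** s) ` T_max"
    then obtain s where "s \<in> T_max" "z = y ** s" by blast
    then have "z = x ** (t ** s)" "t ** s \<in> T_max"
      using t T_max_mult by (simp_all add: matrix_mul_assoc)
    then show "z \<in> (\<lambda>s. x ** s) ` T_max" by blast
  qed
  then show "proj x = proj y" by (simp add: proj_def)
qed

lemma proj_mult_T_max: "x \<in> SU3 \<Longrightarrow> t \<in> T_max \<Longrightarrow> proj (x ** t) = proj x"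
  using proj_eq_iff [of x "x ** t"] SU3_mult T_max_subset by metis

lemma flag_cases:
  obtains x where "x \<in> SU3" "p = proj x"
proof -
  obtain x where "x \<in> SU3" "Rep_flag p = (\<lambda>t. x ** t) ` T_max"
    using Rep_flag [of p] by blast
  then have "p = proj x" by (metis Rep_flag_inverse Rep_flag_proj)
  then show thesis using that \<open>x \<in> SU3\<close> by blast
qed

lemma act_proj: "a \<in> SU3 \<Longrightarrow> x \<in> SU3 \<Longrightarrow> act a (proj x) = proj (a ** x)"
  by (simp add: act_def Rep_flag_proj image_image matrix_mul_assoc proj_def [of "a ** x"])

definition diag_unit :: "3 \<Rightarrow> cmat3" where
  "diag_unit a = (\<chi> i j. if i = a \<and> j = a then 1 else 0)"

lemma ctranspose_diag_unit [simp]: "ctranspose (diag_unit a) = diag_unit a"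
  by (auto simp: vec_eq_iff diag_unit_def)

lemma T_max_commute: "t \<in> T_max \<Longrightarrow> t ** diag_unit a = diag_unit a ** t"
  using exhaust_3 [of a] by (auto simp: cmat3_eq_iff matmul_nth diag_unit_def T_max_nth)

text \<open>The columns of \<open>x\<close> are determined by \<open>proj x\<close> up to phases, so the projections onto their
  spans embed the flag manifold into a space of matrices.\<close>

definition flag_coord :: "3 \<Rightarrow> flag \<Rightarrow> cmat3" where
  "flag_coord a p = (let x = (SOME x. x \<in> SU3 \<and> p = proj x) in x ** diag_unit a ** ctranspose x)"

text \<open>Independence of the chosen representative: two representatives differ by a torus
  element, and diagonal matrices commute with \<open>diag_unit a\<close>.\<close>

lemma flag_coord_proj:
  assumes "x \<in> SU3"
  shows "flag_coord a (proj x) = x ** diag_unit a ** ctranspose x"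
proof -
  define y where "y = (SOME y. y \<in> SU3 \<and> proj x = proj y)"
  have y: "y \<in> SU3" "proj x = proj y"
    using someI [of "\<lambda>y. y \<in> SU3 \<and> proj x = proj y" x] assms unfolding y_def by auto
  then obtain t where t: "t \<in> T_max" "y = x ** t"
    using proj_eq_iff [OF assms] by blast
  have "y ** diag_unit a ** ctranspose y = x ** (t ** diag_unit a ** ctranspose t) ** ctranspose x"
    by (simp add: t ctranspose_mult matrix_mul_assoc)
  also have "t ** diag_unit a ** ctranspose t = diag_unit a"
    by (simp add: T_max_commute t matrix_mul_assoc [symmetric] SU3_right_inverse T_max_subset)
  finally show ?thesis
    by (simp add: flag_coord_def y_def [symmetric])
qed

lemma smooth_fun_flag_coord: "smooth_fun (\<lambda>p. flag_coord a p \<bullet> B)"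
proof -
  have *: "Ck_on k (\<lambda>x. (x ** diag_unit a ** ctranspose x) \<bullet> B) UNIV" for k
    by (intro Ck_on_linear_comp [OF bounded_linear_inner_left] Ck_on_bilinear [OF bounded_bilinear_matmul]
      Ck_on_bounded_linear bounded_linear_matmul_left bounded_linear_ctranspose open_UNIV)
  have "smooth_on SU3 (\<lambda>x. (x ** diag_unit a ** ctranspose x) \<bullet> B)"
    by (rule smooth_onI [OF open_UNIV subset_UNIV *])
  then show ?thesis
    unfolding smooth_fun_def by (rule smooth_on_cong) (simp add: flag_coord_proj)
qed

lemma smooth_fun_act: 
  assumes "smooth_fun \<phi>" "a \<in> SU3"
  shows "smooth_fun (\<lambda>p. \<phi> (act a p))"
proof -
  have "smooth_on SU3 (\<lambda>x. \<phi> (proj (a ** x)))"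
    by (rule smooth_on_comp_linear [OF bounded_linear_matmul_right assms(1)[unfolded smooth_fun_def]])
      (simp add: SU3_mult assms)
  then show ?thesis
    unfolding smooth_fun_def by (rule smooth_on_cong) (simp add: act_proj assms)
qed

section \<open>Curves in the group with prescribed velocity at the identity\<close>

definition mvec :: "complex \<Rightarrow> complex \<Rightarrow> complex \<Rightarrow> cmat3" where
  "mvec u v w = mat3 0 u (- cnj w) (- cnj u) 0 v w (- cnj v) 0"

definition su3 :: "cmat3 set" where
  "su3 = {A. ctranspose A = - A \<and> A$1$1 + A$2$2 + A$3$3 = 0}"

definition mspace :: "cmat3 set" where
  "mspace = {A. ctranspose A = - A \<and> (\<forall>i. A$i$i = 0)}"

definition offdiag :: "cmat3 \<Rightarrow> cmat3" where
  "offdiag A = (\<chi> i j. if i = j then 0 else A $ i $ j)"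

text \<open>The exponential of \<open>t *\<^sub>R mvec u 0 0\<close> in closed form, since the
  square of this matrix is a real multiple of the identity on the first two coordinates. For
  \<open>u = 0\<close> the convention \<open>sgn 0 = 0\<close> yields the identity matrix.\<close>

definition rot1 :: "complex \<Rightarrow> real \<Rightarrow> cmat3" where
  "rot1 u t = (let c = complex_of_real (cos (cmod u * t)); s = complex_of_real (sin (cmod u * t)) in
     mat3 c (s * sgn u) 0 (- s * cnj (sgn u)) c 0 0 0 1)"

definition rot2 :: "complex \<Rightarrow> real \<Rightarrow> cmat3" where
  "rot2 u t = (let c = complex_of_real (cos (cmod u * t)); s = complex_of_real (sin (cmod u * t)) in
     mat3 1 0 0 0 c (s * sgn u) 0 (- s * cnj (sgn u)) c)"

definition rot3 :: "complex \<Rightarrow> real \<Rightarrow> cmat3" where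
  "rot3 u t = (let c = complex_of_real (cos (cmod u * t)); s = complex_of_real (sin (cmod u * t)) in
     mat3 c 0 (- s * cnj (sgn u)) 0 1 0 (s * sgn u) 0 c)"

text \<open>Cosine squared plus sine squared, with the phase cancelling. For \<open>u = 0\<close>
  the phase is zero, but so is the sine.\<close>

lemma rot_aux:
  fixes u :: complex and t :: real
  defines "c \<equiv> complex_of_real (cos (cmod u * t))" and "s \<equiv> complex_of_real (sin (cmod u * t))"
  shows "c * c + s * sgn u * (s * cnj (sgn u)) = 1"
proof (cases "u = 0")
  case False
  then have "sgn u * cnj (sgn u) = 1"
    by (simp add: complex_norm_square [symmetric] norm_sgn)
  then have "c * c + s * sgn u * (s * cnj (sgn u)) = c\<^sup>2 + s\<^sup>2"
    by (simp add: power2_eq_square)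
  also have "\<dots> = 1"
    unfolding c_def s_def by (metis of_real_1 of_real_add of_real_power sin_cos_squared_add2 power2_eq_square)
  finally show ?thesis .
qed (simp add: c_def s_def)

lemma rot_in_SU3: "rot1 u t \<in> SU3" "rot2 u t \<in> SU3" "rot3 u t \<in> SU3"
  using rot_aux [of u t]
  by (simp_all add: SU3_def rot1_def rot2_def rot3_def Let_def det_3 cmat3_eq_iff matmul_nth mat_1_nth
      algebra_simps)

text \<open>A product of three one-parameter subgroups, in general not one itself. It takes the
  place of the exponential of \<open>mvec u v w\<close>: the start and the initial velocity are the
  same.\<close>

definition curve :: "complex \<Rightarrow> complex \<Rightarrow> complex \<Rightarrow> real \<Rightarrow> cmat3" where
  "curve u v w t = rot1 u t ** rot2 v t ** rot3 w t"

lemma curve_in_SU3: "curve u v w t \<in> SU3"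
  by (simp add: curve_def rot_in_SU3 SU3_mult)

lemma curve_0: "curve u v w 0 = mat 1"
proof -
  have "rot1 u 0 = mat 1" "rot2 v 0 = mat 1" "rot3 w 0 = mat 1"
    by (simp_all add: rot1_def rot2_def rot3_def cmat3_eq_iff mat_1_nth)
  then show ?thesis by (simp add: curve_def)
qed

lemma rot_trig:
  "rot1 u = (\<lambda>t. mat3 0 0 0 0 0 0 0 0 1 + cos (cmod u * t) *\<^sub>R mat3 1 0 0 0 1 0 0 0 0
      + sin (cmod u * t) *\<^sub>R mvec (sgn u) 0 0)"
  "rot2 u = (\<lambda>t. mat3 1 0 0 0 0 0 0 0 0 + cos (cmod u * t) *\<^sub>R mat3 0 0 0 0 1 0 0 0 1
      + sin (cmod u * t) *\<^sub>R mvec 0 (sgn u) 0)"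
  "rot3 u = (\<lambda>t. mat3 0 0 0 0 1 0 0 0 0 + cos (cmod u * t) *\<^sub>R mat3 1 0 0 0 0 0 0 0 1
      + sin (cmod u * t) *\<^sub>R mvec 0 0 (sgn u))"
  by (simp_all add: fun_eq_iff rot1_def rot2_def rot3_def mvec_def cmat3_eq_iff Let_def
      scaleR_conv_of_real [where 'a = complex])

lemma Ck_on_rot:
  "Ck_on k (rot1 u) UNIV" "Ck_on k (rot2 u) UNIV" "Ck_on k (rot3 u) UNIV"
  unfolding rot_trig by (rule Ck_on_trig)+

lemma rot_deriv:
  "(rot1 u has_vector_derivative mvec u 0 0) (at 0)"
  "(rot2 u has_vector_derivative mvec 0 u 0) (at 0)"
  "(rot3 u has_vector_derivative mvec 0 0 u) (at 0)"
proof -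
  have trig: "((\<lambda>t. a + cos (r * t) *\<^sub>R b + sin (r * t) *\<^sub>R c) has_vector_derivative r *\<^sub>R c) (at 0)"
    for a b c :: cmat3 and r :: real
    by (auto intro!: derivative_eq_intros)
  have n: "cmod u *\<^sub>R sgn u = u" "cmod u *\<^sub>R cnj (sgn u) = cnj u"
    by (cases "u = 0"; simp add: sgn_div_norm scaleR_conv_of_real)+
  have m: "mvec u 0 0 = cmod u *\<^sub>R mvec (sgn u) 0 0" "mvec 0 u 0 = cmod u *\<^sub>R mvec 0 (sgn u) 0"
    "mvec 0 0 u = cmod u *\<^sub>R mvec 0 0 (sgn u)"
    by (simp_all add: cmat3_eq_iff mvec_def n)
  show "(rot1 u has_vector_derivative mvec u 0 0) (at 0)"
    "(rot2 u has_vector_derivative mvec 0 u 0) (at 0)"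
    "(rot3 u has_vector_derivative mvec 0 0 u) (at 0)"
    unfolding rot_trig m by (rule trig)+
qed

lemma has_vector_derivative_matmul:
  fixes f g :: "real \<Rightarrow> cmat3"
  assumes "(f has_vector_derivative f') (at t)" "(g has_vector_derivative g') (at t)"
  shows "((\<lambda>t. f t ** g t) has_vector_derivative (f t ** g' + f' ** g t)) (at t)"
  by (rule bounded_bilinear.has_vector_derivative [OF bounded_bilinear_matmul assms])

lemma curve_deriv: "(curve u v w has_vector_derivative mvec u v w) (at 0)"
proof -
  have 0: "rot1 u 0 = mat 1" "rot2 v 0 = mat 1" "rot3 w 0 = mat 1"
    by (simp_all add: rot1_def rot2_def rot3_def cmat3_eq_iff mat_1_nth)
  have "((\<lambda>t. rot1 u t ** rot2 v t ** rot3 w t) has_vector_derivative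
      (mat 1 ** mat 1 ** mvec 0 0 w + (mat 1 ** mvec 0 v 0 + mvec u 0 0 ** mat 1) ** mat 1)) (at 0)"
    using has_vector_derivative_matmul
      [OF has_vector_derivative_matmul [OF rot_deriv(1) [of u] rot_deriv(2) [of v]] rot_deriv(3) [of w]]
    by (simp only: 0)
  moreover have "mvec 0 0 w + (mvec 0 v 0 + mvec u 0 0) = mvec u v w"
    by (simp add: cmat3_eq_iff mvec_def)
  ultimately show ?thesis
    unfolding curve_def by simp
qed

lemma smooth_on_curve: "smooth_on UNIV (curve u v w)"
proof (rule smooth_onI [OF open_UNIV subset_UNIV])
  show "Ck_on k (curve u v w) UNIV" for k
    unfolding curve_def [abs_def]
    by (intro Ck_on_bilinear [OF bounded_bilinear_matmul] Ck_on_rot open_UNIV)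
qed

lemma mspace_mvec: "A \<in> mspace \<longleftrightarrow> (\<exists>u v w. A = mvec u v w)"
proof
  assume A: "A \<in> mspace"
  have "cnj (A $ j $ i) = - A $ i $ j" for i j
    using A unfolding mspace_def by (metis (mono_tags, lifting) ctranspose_nth mem_Collect_eq vector_uminus_component)
  then have "A = mvec (A$1$2) (A$2$3) (A$3$1)"
    using A by (simp add: mspace_def cmat3_eq_iff mvec_def)
  then show "\<exists>u v w. A = mvec u v w" by blast
qed (auto simp: mspace_def mvec_def cmat3_eq_iff forall_3)

section \<open>Tangent vectors\<close>

text \<open>Chain rule through a local extension \<open>G\<close>: near time 0 the curve stays in
  \<open>U\<close> and in the group, where \<open>G\<close> agrees with the lifted function. The
  derivative therefore depends on the curve through \<open>x\<close> only by its velocity.\<close>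

lemma lift_has_derivative:
  assumes G: "open U" "x \<in> U" "\<forall>k. Ck_on k G U" "\<forall>y\<in>U \<inter> SU3. G y = \<phi> (proj y)"
    and \<gamma>: "\<forall>t. \<gamma> t \<in> SU3" "\<gamma> 0 = x" "(\<gamma> has_vector_derivative D) (at 0)"
  shows "((\<lambda>t. \<phi> (proj (\<gamma> t))) has_real_derivative frechet_derivative G (at x) D) (at 0)"
proof -
  define L where "L = frechet_derivative G (at x)"
  have GL: "(G has_derivative L) (at x)"
    unfolding L_def by (rule Ck_on_has_derivative [OF spec [OF G(3), of "Suc 0"] G(2)])
  have "((\<lambda>t. G (\<gamma> t)) has_derivative (\<lambda>s. L (s *\<^sub>R D))) (at 0)"
    using diff_chain_at [OF \<gamma>(3) [unfolded has_vector_derivative_def], of G L] GL \<gamma>(2)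
    by (simp add: o_def)
  then have G': "((\<lambda>t. G (\<gamma> t)) has_real_derivative L D) (at 0)"
    using linear_scale [OF has_derivative_linear [OF GL]]
    by (simp add: has_field_derivative_def mult.commute [of _ "L D"])
  have "continuous (at 0) \<gamma>"
    by (rule has_vector_derivative_continuous [OF \<gamma>(3)])
  then have "\<forall>\<^sub>F t in nhds 0. \<gamma> t \<in> U"
    using G(1,2) \<gamma>(2) by (simp add: continuous_at_open eventually_nhds)
  then have ev: "\<forall>\<^sub>F t in nhds 0. G (\<gamma> t) = \<phi> (proj (\<gamma> t))"
    by (rule eventually_mono) (use G(4) \<gamma>(1) in blast)
  show ?thesis
    unfolding L_def [symmetric] by (rule iffD1 [OF DERIV_cong_ev [OF refl ev refl] G'])
qed

text \<open>The functional precedes the curve in the quantifiers: it is the derivative of one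
  extension at \<open>x\<close>, common to all curves through \<open>x\<close>.\<close>

lemma smooth_fun_lift:
  assumes "smooth_fun \<phi>" "x \<in> SU3"
  shows "\<exists>L. bounded_linear L \<and> (\<forall>\<gamma> D. (\<forall>t. \<gamma> t \<in> SU3) \<and> \<gamma> 0 = x \<and>
    (\<gamma> has_vector_derivative D) (at 0) \<longrightarrow>
    ((\<lambda>t. \<phi> (proj (\<gamma> t))) has_real_derivative L D) (at 0))"
proof -
  obtain U G where *: "open U" "x \<in> U" "\<forall>k. Ck_on k G U" "\<forall>y\<in>U \<inter> SU3. G y = \<phi> (proj y)"
    by (rule smooth_onE [OF assms(1)[unfolded smooth_fun_def] assms(2)])
  have "bounded_linear (frechet_derivative G (at x))"
    by (rule has_derivative_bounded_linear
        [OF Ck_on_has_derivative [OF spec [OF *(3), of "Suc 0"] *(2)]])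
  then show ?thesis
    using lift_has_derivative [OF *]
    by (intro exI [of _ "frechet_derivative G (at x)"] conjI allI impI) simp_all
qed

text \<open>The differential of the lifted function. The condition fixes it on velocities of curves
  in the group; on other matrices the value depends on the choice.\<close>

definition dlift :: "(flag \<Rightarrow> real) \<Rightarrow> cmat3 \<Rightarrow> cmat3 \<Rightarrow> real" where
  "dlift \<phi> x = (SOME L. bounded_linear L \<and> (\<forall>\<gamma> D. (\<forall>t. \<gamma> t \<in> SU3) \<and> \<gamma> 0 = x \<and>
    (\<gamma> has_vector_derivative D) (at 0) \<longrightarrow>
    ((\<lambda>t. \<phi> (proj (\<gamma> t))) has_real_derivative L D) (at 0)))"

lemma
  assumes "smooth_fun \<phi>" "x \<in> SU3"
  shows bounded_linear_dlift: "bounded_linear (dlift \<phi> x)"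
    and has_derivative_dlift: "\<And>\<gamma> D. (\<And>t. \<gamma> t \<in> SU3) \<Longrightarrow> \<gamma> 0 = x \<Longrightarrow>
      (\<gamma> has_vector_derivative D) (at 0) \<Longrightarrow>
      ((\<lambda>t. \<phi> (proj (\<gamma> t))) has_real_derivative dlift \<phi> x D) (at 0)"
  using someI_ex [OF smooth_fun_lift [OF assms]] unfolding dlift_def by blast+

lemma velocity_eq:
  assumes "\<And>t. \<gamma> t \<in> SU3" "\<gamma> 0 = x" "(\<gamma> has_vector_derivative D) (at 0)"
  shows "velocity (\<lambda>t. proj (\<gamma> t)) = (\<lambda>\<phi>. if smooth_fun \<phi> then dlift \<phi> x D else 0)"
  using has_derivative_dlift [OF _ _ assms] assms(1)[of 0] assms(2)
  by (auto simp: velocity_def fun_eq_iff intro!: DERIV_imp_deriv)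

lemma su3_mspace: "mspace \<subseteq> su3"
  by (auto simp: mspace_def su3_def)

lemma subspace_su3: "subspace su3"
proof (rule subspaceI)
  fix A B assume "A \<in> su3" "B \<in> su3"
  moreover have "(A + B)$1$1 + (A + B)$2$2 + (A + B)$3$3 =
      (A$1$1 + A$2$2 + A$3$3) + (B$1$1 + B$2$2 + B$3$3)"
    by simp
  ultimately show "A + B \<in> su3"
    by (simp only: su3_def mem_Collect_eq ctranspose_linear_simps) simp
next
  fix A and c :: real assume "A \<in> su3"
  moreover have "(c *\<^sub>R A)$1$1 + (c *\<^sub>R A)$2$2 + (c *\<^sub>R A)$3$3 = c *\<^sub>R (A$1$1 + A$2$2 + A$3$3)"
    by (simp add: scaleR_add_right)
  ultimately show "c *\<^sub>R A \<in> su3"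
    by (simp only: su3_def mem_Collect_eq ctranspose_linear_simps) simp
qed (simp add: su3_def ctranspose_linear_simps)

lemma subspace_mspace: "subspace mspace"
  by (auto simp: subspace_def mspace_def ctranspose_linear_simps)

lemma linear_offdiag: "linear offdiag"
  by (rule linearI) (simp_all add: vec_eq_iff offdiag_def)

lemma offdiag_mspace: "A \<in> mspace \<Longrightarrow> offdiag A = A"
  by (auto simp: vec_eq_iff offdiag_def mspace_def)

lemma offdiag_su3: "A \<in> su3 \<Longrightarrow> offdiag A \<in> mspace"
  by (auto simp: vec_eq_iff offdiag_def mspace_def su3_def)

text \<open>After translation to the identity, differentiating unitarity makes the velocity
  skew-Hermitian, and differentiating the determinant makes its trace zero.\<close>

lemma SU3_curve_derivative:
  assumes "\<And>t. \<gamma> t \<in> SU3" "\<gamma> 0 = x" "(\<gamma> has_vector_derivative D) (at 0)"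
  shows "ctranspose x ** D \<in> su3"
proof -
  define A where "A = ctranspose x ** D"
  have x: "x \<in> SU3" using assms by blast
  define \<delta> where "\<delta> t = ctranspose x ** \<gamma> t" for t
  have \<delta>: "\<delta> t \<in> SU3" "\<delta> 0 = mat 1" for t
    using assms x by (auto simp: \<delta>_def SU3_mult SU3_ctranspose SU3_left_inverse)
  have d: "(\<delta> has_vector_derivative A) (at 0)"
    unfolding \<delta>_def A_def
    by (rule bounded_linear.has_vector_derivative [OF bounded_linear_matmul_right assms(3)])
  have "((\<lambda>t. ctranspose (\<delta> t) ** \<delta> t) has_vector_derivative
      (ctranspose (\<delta> 0) ** A + ctranspose A ** \<delta> 0)) (at 0)"
    by (rule has_vector_derivative_matmul
          [OF bounded_linear.has_vector_derivative [OF bounded_linear_ctranspose d] d])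
  then have "((\<lambda>t. mat 1) has_vector_derivative (A + ctranspose A)) (at 0)"
    by (simp add: SU3_left_inverse \<delta>)
  then have "A + ctranspose A = 0"
    using vector_derivative_unique_at has_vector_derivative_const by blast
  then have skew: "ctranspose A = - A"
    by (simp add: add_eq_0_iff)
  have comp: "((\<lambda>t. \<delta> t $ i $ j) has_vector_derivative A $ i $ j) (at 0)" for i j
    by (rule bounded_linear.has_vector_derivative
        [OF bounded_linear_vec_nth bounded_linear.has_vector_derivative [OF bounded_linear_vec_nth d]])
  have "((\<lambda>t. det (\<delta> t)) has_vector_derivative (A$1$1 + A$2$2 + A$3$3)) (at 0)"
    unfolding det_3
    by (rule has_vector_derivative_eq_rhs, (rule has_vector_derivative_add has_vector_derivative_diff
          has_vector_derivative_mult comp)+) (simp add: \<delta> mat_1_nth)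
  then have "((\<lambda>t. 1) has_vector_derivative (A$1$1 + A$2$2 + A$3$3)) (at 0)"
    using \<delta>(1) by (simp add: SU3_def)
  then have "A$1$1 + A$2$2 + A$3$3 = 0"
    using vector_derivative_unique_at has_vector_derivative_const by blast
  then show ?thesis
    using skew by (simp add: su3_def A_def)
qed

text \<open>Torus directions are vertical: a diagonal \<open>H\<close> is the velocity of a curve
  \<open>d\<close> in the torus, and \<open>x ** d t\<close> stays in one coset.\<close>

lemma dlift_diagonal:
  assumes "smooth_fun \<phi>" "x \<in> SU3" "H \<in> su3" "offdiag H = 0"
  shows "dlift \<phi> x (x ** H) = 0"
proof -
  define a b where "a = Im (H$1$1)" and "b = Im (H$2$2)"
  have "cnj (H $ i $ i) = - H $ i $ i" for i
    using assms(3) unfolding su3_def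
    by (metis (mono_tags, lifting) ctranspose_nth mem_Collect_eq vector_uminus_component)
  then have "Re (H $ i $ i) = 0" for i
    by (simp add: complex_eq_iff)
  then have 1: "H$1$1 = \<i> * a" "H$2$2 = \<i> * b" and 3: "H$3$3 = - (\<i> * (a + b))"
    using assms(3) by (auto simp: complex_eq_iff a_def b_def su3_def)
  have H: "H = mat3 (\<i> * a) 0 0 0 (\<i> * b) 0 0 0 (- (\<i> * (a + b)))"
  proof -
    have "H $ i $ j = 0" if "i \<noteq> j" for i j
      using arg_cong [OF assms(4), of "\<lambda>M. M $ i $ j"] that by (simp add: offdiag_def)
    then show ?thesis by (simp add: cmat3_eq_iff 1 3)
  qed
  define d where "d t = mat3 (cis (a * t)) 0 0 0 (cis (b * t)) 0 0 0 (cis (- (a + b) * t))" for t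
  have T: "d t \<in> T_max" for t
    by (auto simp: d_def T_max_def SU3_def det_3 cmat3_eq_iff matmul_nth mat_1_nth forall_3
        cis_cnj cis_mult algebra_simps)
  have d0: "d 0 = mat 1"
    by (simp add: d_def cmat3_eq_iff mat_1_nth)
  \<comment> \<open>Splitting each \<open>cis\<close> into cosine and sine with constant matrices
    brings the curve into the form that \<open>trig\<close> differentiates.\<close>
  have d_eq: "d = (\<lambda>t. (cos (a * t) *\<^sub>R mat3 1 0 0 0 0 0 0 0 0 + sin (a * t) *\<^sub>R mat3 \<i> 0 0 0 0 0 0 0 0)
     + (cos (b * t) *\<^sub>R mat3 0 0 0 0 1 0 0 0 0 + sin (b * t) *\<^sub>R mat3 0 0 0 0 \<i> 0 0 0 0)
     + (cos (- (a + b) * t) *\<^sub>R mat3 0 0 0 0 0 0 0 0 1 + sin (- (a + b) * t) *\<^sub>R mat3 0 0 0 0 0 0 0 0 \<i>))"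
    by (simp add: fun_eq_iff d_def cmat3_eq_iff complex_eq_iff)
  have trig: "((\<lambda>t. cos (r * t) *\<^sub>R b + sin (r * t) *\<^sub>R c) has_vector_derivative r *\<^sub>R c) (at 0)"
    for b c :: cmat3 and r :: real
    by (auto intro!: derivative_eq_intros)
  have "(d has_vector_derivative (a *\<^sub>R mat3 \<i> 0 0 0 0 0 0 0 0 + b *\<^sub>R mat3 0 0 0 0 \<i> 0 0 0 0
       + (- (a + b)) *\<^sub>R mat3 0 0 0 0 0 0 0 0 \<i>)) (at 0)"
    unfolding d_eq by (intro has_vector_derivative_add trig)
  also have "(a *\<^sub>R mat3 \<i> 0 0 0 0 0 0 0 0 + b *\<^sub>R mat3 0 0 0 0 \<i> 0 0 0 0
       + (- (a + b)) *\<^sub>R mat3 0 0 0 0 0 0 0 0 \<i>) = H"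
    by (simp add: H cmat3_eq_iff complex_eq_iff)
  finally have "(d has_vector_derivative H) (at 0)" .
  then have "((\<lambda>t. x ** d t) has_vector_derivative x ** H) (at 0)"
    by (rule bounded_linear.has_vector_derivative [OF bounded_linear_matmul_right])
  then have "((\<lambda>t. \<phi> (proj (x ** d t))) has_real_derivative dlift \<phi> x (x ** H)) (at 0)"
    by (rule has_derivative_dlift [OF assms(1,2), rotated 2])
      (simp_all add: d0 SU3_mult T T_max_subset assms(2))
  moreover have "proj (x ** d t) = proj x" for t
    by (rule proj_mult_T_max [OF assms(2) T])
  ultimately have "((\<lambda>t. \<phi> (proj x)) has_real_derivative dlift \<phi> x (x ** H)) (at 0)"
    by simp
  then show ?thesis
    using DERIV_const DERIV_unique by blast
qed

lemma dlift_offdiag: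
  assumes "smooth_fun \<phi>" "x \<in> SU3" "A \<in> su3"
  shows "dlift \<phi> x (x ** offdiag A) = dlift \<phi> x (x ** A)"
proof -
  have "A - offdiag A \<in> su3"
    using assms(3) offdiag_su3 su3_mspace subspace_su3 by (blast intro: subspace_diff)
  moreover have "offdiag (A - offdiag A) = 0"
    by (simp add: vec_eq_iff offdiag_def)
  ultimately have "dlift \<phi> x (x ** A - x ** offdiag A) = 0"
    using dlift_diagonal [OF assms(1,2), of "A - offdiag A"] by (simp add: matmul_diff_right)
  then show ?thesis
    using linear_diff [OF bounded_linear.linear [OF bounded_linear_dlift [OF assms(1,2)]]] by simp
qed

text \<open>Junk value: \<open>tv x A\<close> reads only three entries of \<open>A\<close>, and is the tangent vector with frame
  coordinates \<open>A\<close> only for \<open>A\<close> in \<open>mspace\<close>.\<close>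

definition tv :: "cmat3 \<Rightarrow> cmat3 \<Rightarrow> tvec" where
  "tv x A = velocity (\<lambda>t. proj (x ** curve (A$1$2) (A$2$3) (A$3$1) t))"

lemma mvec_components: "A \<in> mspace \<Longrightarrow> mvec (A$1$2) (A$2$3) (A$3$1) = A"
  by (auto simp: mspace_mvec mvec_def)

lemma has_vector_derivative_curve:
  fixes x :: cmat3
  assumes "A \<in> mspace"
  shows "((\<lambda>t. x ** curve (A$1$2) (A$2$3) (A$3$1) t) has_vector_derivative x ** A) (at 0)"
  using bounded_linear.has_vector_derivative [OF bounded_linear_matmul_right [of x]
      curve_deriv [of "A$1$2" "A$2$3" "A$3$1"]] assms
  by (simp add: mvec_components)

lemma tv_eq:
  assumes "x \<in> SU3" "A \<in> mspace"
  shows "tv x A = (\<lambda>\<phi>. if smooth_fun \<phi> then dlift \<phi> x (x ** A) else 0)"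
  unfolding tv_def
  by (rule velocity_eq [OF _ _ has_vector_derivative_curve [OF assms(2)]])
    (simp_all add: assms SU3_mult curve_in_SU3 curve_0)

text \<open>The left-translated velocity of a lift is its value under the Maurer-Cartan form. Its
  diagonal part is vertical and dies in the quotient; the rest gives the frame coordinates.\<close>

lemma velocity_eq_tv:
  assumes "\<And>t. \<gamma> t \<in> SU3" "\<gamma> 0 = x" "(\<gamma> has_vector_derivative D) (at 0)"
  shows "velocity (\<lambda>t. proj (\<gamma> t)) = tv x (offdiag (ctranspose x ** D))"
proof -
  have x: "x \<in> SU3" using assms by blast
  have A: "ctranspose x ** D \<in> su3"
    by (rule SU3_curve_derivative [OF assms])
  show ?thesis
    unfolding velocity_eq [OF assms] tv_eq [OF x offdiag_su3 [OF A]]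
    using dlift_offdiag [OF _ x A] by (auto simp: fun_eq_iff SU3_cancel x)
qed

lemma tv_in_tangent_space:
  assumes "x \<in> SU3"
  shows "tv x A \<in> tangent_space (proj x)"
proof -
  have "smooth_on UNIV (\<lambda>t. x ** curve (A$1$2) (A$2$3) (A$3$1) t)"
    by (rule smooth_on_linear_comp [OF bounded_linear_matmul_right smooth_on_curve])
  then show ?thesis
    unfolding tangent_space_def tv_def
    using assms by (auto simp: SU3_mult curve_in_SU3 curve_0 intro!: exI)
qed

lemma tangent_space_tv:
  assumes "x \<in> SU3" "v \<in> tangent_space (proj x)"
  obtains A where "A \<in> mspace" "v = tv x A"
proof -
  obtain \<gamma> where \<gamma>: "smooth_on UNIV \<gamma>" "\<And>t. \<gamma> t \<in> SU3" "proj (\<gamma> 0) = proj x"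
    and v: "v = velocity (\<lambda>t. proj (\<gamma> t))"
    using assms(2) unfolding tangent_space_def by blast
  \<comment> \<open>The given lift starts somewhere in the coset of \<open>x\<close>. Right
    multiplication by \<open>s\<close> makes it start at \<open>x\<close> without changing its
    projection.\<close>
  obtain s where s: "s \<in> T_max" "x = \<gamma> 0 ** s"
    using \<gamma> proj_eq_iff assms(1) by blast
  obtain D where "(\<gamma> has_vector_derivative D) (at 0)"
    using smooth_curve_has_vector_derivative [OF \<gamma>(1)] by blast
  then have D: "((\<lambda>t. \<gamma> t ** s) has_vector_derivative D ** s) (at 0)"
    by (rule bounded_linear.has_vector_derivative [OF bounded_linear_matmul_left])
  have in_SU3: "\<gamma> t ** s \<in> SU3" for t
    using s \<gamma> by (simp add: SU3_mult T_max_subset)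
  have "v = velocity (\<lambda>t. proj (\<gamma> t ** s))"
    using v \<gamma>(2) s by (simp add: proj_mult_T_max)
  also have "\<dots> = tv x (offdiag (ctranspose x ** (D ** s)))"
    by (rule velocity_eq_tv [OF in_SU3 s(2) [symmetric] D])
  finally show thesis
    by (rule that [OF offdiag_su3 [OF SU3_curve_derivative [OF in_SU3 s(2) [symmetric] D]]])
qed

lemma tv_add_tv:
  assumes "x \<in> SU3" "A \<in> mspace" "B \<in> mspace"
  shows "tv_add (tv x A) (tv x B) = tv x (A + B)"
proof -
  have "A + B \<in> mspace" using assms subspace_mspace by (blast intro: subspace_add)
  then show ?thesis
    using linear_add [OF bounded_linear.linear [OF bounded_linear_dlift [OF _ assms(1)]]]
    by (simp add: tv_add_def tv_eq assms fun_eq_iff matmul_add_right)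
qed

lemma tv_diff_tv:
  assumes "x \<in> SU3" "A \<in> mspace" "B \<in> mspace"
  shows "tv_diff (tv x A) (tv x B) = tv x (A - B)"
proof -
  have "A - B \<in> mspace" using assms subspace_mspace by (blast intro: subspace_diff)
  then show ?thesis
    using linear_diff [OF bounded_linear.linear [OF bounded_linear_dlift [OF _ assms(1)]]]
    by (simp add: tv_diff_def tv_eq assms fun_eq_iff matmul_diff_right)
qed

lemma tv_scale_tv:
  assumes "x \<in> SU3" "A \<in> mspace"
  shows "tv_scale c (tv x A) = tv x (c *\<^sub>R A)"
proof -
  have "c *\<^sub>R A \<in> mspace" using assms subspace_mspace by (blast intro: subspace_scale)
  then show ?thesis
    using linear_scale [OF bounded_linear.linear [OF bounded_linear_dlift [OF _ assms(1)]]]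
    by (simp add: tv_scale_def tv_eq assms fun_eq_iff matmul_scaleR_right)
qed

lemma tv_zero_eq:
  assumes "x \<in> SU3"
  shows "tv x 0 = tv_zero"
  using tv_scale_tv [OF assms subspace_0 [OF subspace_mspace], of 0]
  by (simp add: tv_scale_def tv_zero_def)

section \<open>Recovering frame coordinates from a tangent vector\<close>

definition coord_deriv :: "3 \<Rightarrow> tvec \<Rightarrow> cmat3" where
  "coord_deriv a v = (\<Sum>B\<in>Basis. v (\<lambda>p. flag_coord a p \<bullet> B) *\<^sub>R B)"

text \<open>On a tangent vector with frame coordinates \<open>A\<close>, the conjugated derivative of the \<open>j\<close>-th
  projection is the commutator of \<open>A\<close> with \<open>diag_unit j\<close>, whose \<open>j\<close>-th column is that of \<open>A\<close> off the
  diagonal.\<close>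

definition hat :: "cmat3 \<Rightarrow> tvec \<Rightarrow> cmat3" where
  "hat x v = (\<chi> i j. if i = j then 0 else (ctranspose x ** coord_deriv j v ** x) $ i $ j)"

text \<open>\<open>C\<close> may have diagonal entries and \<open>v\<close> may be any functional:
  for a bracket of vector fields, \<open>C\<close> contains a full matrix commutator.\<close>

lemma hat_eq_offdiag:
  assumes "x \<in> SU3" "\<And>a. coord_deriv a v = x ** (C ** diag_unit a - diag_unit a ** C) ** ctranspose x"
  shows "hat x v = offdiag C"
proof -
  have "ctranspose x ** coord_deriv a v ** x = ctranspose x ** (x ** ((C ** diag_unit a - diag_unit a ** C) ** (ctranspose x ** x)))" for a
    by (simp only: assms(2) matrix_mul_assoc)
  also have "\<dots> a = C ** diag_unit a - diag_unit a ** C" for a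
    by (simp only: SU3_cancel SU3_left_inverse assms matrix_mul_rid)
  finally have "hat x v = (\<chi> i j. if i = j then 0 else (C ** diag_unit j - diag_unit j ** C) $ i $ j)"
    by (simp add: hat_def cong: if_cong)
  also have "\<dots> = offdiag C"
    by (simp add: cmat3_eq_iff offdiag_def matmul_nth diag_unit_def)
  finally show ?thesis .
qed

text \<open>Product rule for conjugation of a fixed matrix along a curve;
  \<open>ctranspose A = - A\<close> turns the two terms into a commutator.\<close>

lemma coord_deriv_tv:
  assumes "x \<in> SU3" "A \<in> mspace"
  shows "coord_deriv a (tv x A) = x ** (A ** diag_unit a - diag_unit a ** A) ** ctranspose x"
proof -
  let ?\<gamma> = "\<lambda>t. x ** curve (A$1$2) (A$2$3) (A$3$1) t"
  have \<gamma>: "?\<gamma> t \<in> SU3" "?\<gamma> 0 = x" for t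
    using assms by (simp_all add: SU3_mult curve_in_SU3 curve_0)
  define M where "M = x ** (A ** diag_unit a - diag_unit a ** A) ** ctranspose x"
  have "((\<lambda>t. ?\<gamma> t ** diag_unit a ** ctranspose (?\<gamma> t)) has_vector_derivative
     ?\<gamma> 0 ** diag_unit a ** ctranspose (x ** A) + (x ** A) ** diag_unit a ** ctranspose (?\<gamma> 0)) (at 0)"
    by (rule has_vector_derivative_matmul has_vector_derivative_curve assms
        bounded_linear.has_vector_derivative [OF bounded_linear_matmul_left]
        bounded_linear.has_vector_derivative [OF bounded_linear_ctranspose])+
  also have "?\<gamma> 0 ** diag_unit a ** ctranspose (x ** A) + (x ** A) ** diag_unit a ** ctranspose (?\<gamma> 0) = M"
    using assms(2) by (simp add: M_def \<gamma> ctranspose_mult mspace_def matmul_linear_simps matrix_mul_assoc)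
  finally have M: "((\<lambda>t. ?\<gamma> t ** diag_unit a ** ctranspose (?\<gamma> t)) has_vector_derivative M) (at 0)" .
  have "tv x A (\<lambda>p. flag_coord a p \<bullet> B) = M \<bullet> B" for B
  proof -
    have "((\<lambda>t. (?\<gamma> t ** diag_unit a ** ctranspose (?\<gamma> t)) \<bullet> B) has_vector_derivative M \<bullet> B) (at 0)"
      by (rule bounded_linear.has_vector_derivative [OF bounded_linear_inner_left M])
    then have "((\<lambda>t. flag_coord a (proj (?\<gamma> t)) \<bullet> B) has_real_derivative M \<bullet> B) (at 0)"
      by (simp add: flag_coord_proj \<gamma> has_real_derivative_iff_has_vector_derivative)
    then show ?thesis
      by (simp add: tv_def velocity_def smooth_fun_flag_coord DERIV_imp_deriv)
  qed
  then show ?thesis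
    by (simp add: coord_deriv_def M_def [symmetric] euclidean_representation)
qed

text \<open>This is the injectivity of the frame: distinct elements of \<open>mspace\<close> give
  distinct functionals, since the projections detect every off-diagonal entry.\<close>

lemma hat_tv: "x \<in> SU3 \<Longrightarrow> A \<in> mspace \<Longrightarrow> hat x (tv x A) = A"
  using hat_eq_offdiag [OF _ coord_deriv_tv] by (simp add: offdiag_mspace)

lemma hat_in_mspace: "x \<in> SU3 \<Longrightarrow> v \<in> tangent_space (proj x) \<Longrightarrow> hat x v \<in> mspace"
  by (metis hat_tv tangent_space_tv)

lemma tv_hat: "x \<in> SU3 \<Longrightarrow> v \<in> tangent_space (proj x) \<Longrightarrow> tv x (hat x v) = v"
  by (metis hat_tv tangent_space_tv)

lemma hat_inject:
  "x \<in> SU3 \<Longrightarrow> v \<in> tangent_space (proj x) \<Longrightarrow> w \<in> tangent_space (proj x) \<Longrightarrow>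
    hat x v = hat x w \<longleftrightarrow> v = w"
  by (metis tv_hat)

lemma coord_deriv_linear_simps:
  "coord_deriv a (tv_add v w) = coord_deriv a v + coord_deriv a w" "coord_deriv a (tv_diff v w) = coord_deriv a v - coord_deriv a w"
  "coord_deriv a (tv_scale c v) = c *\<^sub>R coord_deriv a v" "coord_deriv a tv_zero = 0"
  by (simp_all add: coord_deriv_def tv_add_def tv_diff_def tv_scale_def tv_zero_def scaleR_add_left
      scaleR_diff_left sum.distrib sum_subtractf scaleR_sum_right)

lemma hat_linear_simps:
  "hat x (tv_add v w) = hat x v + hat x w" "hat x (tv_diff v w) = hat x v - hat x w"
  "hat x (tv_scale c v) = c *\<^sub>R hat x v" "hat x tv_zero = 0"
  by (simp_all add: vec_eq_iff hat_def coord_deriv_linear_simps matmul_linear_simps)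

lemma tangent_space_closed:
  assumes "v \<in> tangent_space p" "w \<in> tangent_space p"
  shows "tv_add v w \<in> tangent_space p" "tv_diff v w \<in> tangent_space p"
    "tv_scale c v \<in> tangent_space p" "tv_zero \<in> tangent_space p"
proof -
  obtain x where x: "x \<in> SU3" "p = proj x" by (rule flag_cases)
  obtain A B where "A \<in> mspace" "v = tv x A" "B \<in> mspace" "w = tv x B"
    using assms x tangent_space_tv by metis
  then show "tv_add v w \<in> tangent_space p" "tv_diff v w \<in> tangent_space p"
    "tv_scale c v \<in> tangent_space p" "tv_zero \<in> tangent_space p"
    using x(1) by (simp_all add: x(2) tv_add_tv tv_diff_tv tv_scale_tv tv_in_tangent_space
        flip: tv_zero_eq [OF x(1)])
qed

text \<open>The frame is left-invariant, so translation changes the base point and keeps the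
  coordinates. The value 0 on non-smooth functions is respected because translation by
  \<open>a\<close> preserves smoothness in both directions.\<close>

lemma push_tv:
  assumes "a \<in> SU3" "x \<in> SU3" "A \<in> mspace"
  shows "push a (tv x A) = tv (a ** x) A"
proof
  fix \<phi>
  have "smooth_fun (\<lambda>p. \<phi> (act a p)) \<longleftrightarrow> smooth_fun \<phi>"
  proof
    assume "smooth_fun (\<lambda>p. \<phi> (act a p))"
    then have "smooth_fun (\<lambda>p. \<phi> (act a (act (ctranspose a) p)))"
      by (rule smooth_fun_act) (simp add: assms SU3_ctranspose)
    moreover have "act a (act (ctranspose a) p) = p" for p
      by (rule flag_cases [of p]) (simp add: act_proj assms SU3_mult SU3_ctranspose SU3_cancel)
    ultimately show "smooth_fun \<phi>" by simp
  qed (rule smooth_fun_act [OF _ assms(1)])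
  then show "push a (tv x A) \<phi> = tv (a ** x) A \<phi>"
    by (simp add: push_def tv_def velocity_def act_proj assms SU3_mult curve_in_SU3 matrix_mul_assoc)
qed

lemma mspace_T_max_conj:
  assumes "s \<in> T_max" "A \<in> mspace"
  shows "ctranspose s ** A ** s \<in> mspace"
proof -
  have "ctranspose (ctranspose s ** A ** s) = - (ctranspose s ** A ** s)"
    using assms(2) by (simp add: ctranspose_mult mspace_def matmul_linear_simps matrix_mul_assoc)
  moreover have "(ctranspose s ** A ** s) $ i $ i = 0" for i
    using assms(2) T_max_nth [OF assms(1)] exhaust_3 [of i] by (auto simp: matmul_nth mspace_def)
  ultimately show ?thesis
    by (simp add: mspace_def)
qed

text \<open>The isotropy representation: changing the representative of a coset by \<open>s\<close>
  multiplies a lifted curve by \<open>s\<close> on the right and conjugates its left-translated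
  velocity.\<close>

lemma tv_T_max:
  assumes "x \<in> SU3" "s \<in> T_max" "A \<in> mspace"
  shows "tv x A = tv (x ** s) (ctranspose s ** A ** s)"
proof -
  let ?\<gamma> = "\<lambda>t. x ** curve (A$1$2) (A$2$3) (A$3$1) t"
  have s: "s \<in> SU3" using assms T_max_subset by blast
  have "tv x A = velocity (\<lambda>t. proj (?\<gamma> t ** s))"
    by (simp add: tv_def proj_mult_T_max assms SU3_mult curve_in_SU3)
  also have "\<dots> = tv (x ** s) (offdiag (ctranspose (x ** s) ** (x ** A ** s)))"
    by (rule velocity_eq_tv)
      (simp_all add: s assms SU3_mult curve_in_SU3 curve_0 has_vector_derivative_curve
        bounded_linear.has_vector_derivative [OF bounded_linear_matmul_left])
  also have "ctranspose (x ** s) ** (x ** A ** s) = ctranspose s ** (ctranspose x ** (x ** (A ** s)))"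
    by (simp add: ctranspose_mult matrix_mul_assoc)
  also have "\<dots> = ctranspose s ** A ** s"
    by (simp only: SU3_cancel assms) (simp only: matrix_mul_assoc)
  also have "offdiag (ctranspose s ** A ** s) = ctranspose s ** A ** s"
    by (intro offdiag_mspace mspace_T_max_conj assms)
  finally show ?thesis .
qed

section \<open>Vector fields in the global frame\<close>

text \<open>Conjugating by \<open>y\<close> makes these fields take every tangent vector as a value at \<open>proj y\<close>.\<close>

definition fundamental_field :: "cmat3 \<Rightarrow> cmat3 \<Rightarrow> vfield" where
  "fundamental_field y A p = velocity (\<lambda>t. act (y ** curve (A$1$2) (A$2$3) (A$3$1) t ** ctranspose y) p)"

lemma fundamental_field_curve:
  assumes "x \<in> SU3" "y \<in> SU3" "A \<in> mspace"
  defines "\<gamma> \<equiv> \<lambda>t. y ** curve (A$1$2) (A$2$3) (A$3$1) t ** ctranspose y ** x"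
  shows "\<gamma> t \<in> SU3" "\<gamma> 0 = x" "(\<gamma> has_vector_derivative y ** A ** ctranspose y ** x) (at 0)"
    "smooth_on UNIV \<gamma>" "fundamental_field y A (proj x) = velocity (\<lambda>t. proj (\<gamma> t))"
proof -
  show "\<gamma> t \<in> SU3"
    by (simp add: \<gamma>_def assms SU3_mult SU3_ctranspose curve_in_SU3)
  show "\<gamma> 0 = x"
    by (simp add: \<gamma>_def curve_0 assms SU3_right_inverse)
  show "(\<gamma> has_vector_derivative y ** A ** ctranspose y ** x) (at 0)"
    unfolding \<gamma>_def
    by (intro bounded_linear.has_vector_derivative [OF bounded_linear_matmul_left]
        has_vector_derivative_curve assms)
  show "smooth_on UNIV \<gamma>"
    unfolding \<gamma>_def
    by (intro smooth_on_linear_comp [OF bounded_linear_matmul_left]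
        smooth_on_linear_comp [OF bounded_linear_matmul_right] smooth_on_curve)
  show "fundamental_field y A (proj x) = velocity (\<lambda>t. proj (\<gamma> t))"
    by (simp add: fundamental_field_def \<gamma>_def act_proj assms SU3_mult SU3_ctranspose curve_in_SU3)
qed

text \<open>On the group such a field lifts to \<open>z \<mapsto> ?M ** z\<close>. With a local
  extension \<open>G\<close> the Lie derivative is the derivative of \<open>G\<close> in a direction
  linear in the point, which \<open>Ck_on_directional\<close> covers.\<close>

lemma fundamental_field_in_vector_fields:
  assumes "y \<in> SU3" "A \<in> mspace"
  shows "fundamental_field y A \<in> vector_fields"
  unfolding vector_fields_def
proof (intro CollectI conjI allI impI)
  fix p
  obtain x where x: "x \<in> SU3" "p = proj x" by (rule flag_cases)
  show "fundamental_field y A p \<in> tangent_space p"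
    unfolding x(2) tangent_space_def
    using fundamental_field_curve [OF x(1) assms] by (intro CollectI exI conjI allI) (assumption | simp)+
next
  fix \<phi> assume \<phi>: "smooth_fun \<phi>"
  let ?M = "y ** A ** ctranspose y"
  show "smooth_fun (lie_derivative (fundamental_field y A) \<phi>)"
    unfolding smooth_fun_def smooth_on_def
  proof
    fix x assume "x \<in> SU3"
    obtain U G where *: "open U" "x \<in> U" "\<forall>k. Ck_on k G U" "\<forall>y\<in>U \<inter> SU3. G y = \<phi> (proj y)"
      by (rule smooth_onE [OF \<phi>[unfolded smooth_fun_def] \<open>x \<in> SU3\<close>])
    have "lie_derivative (fundamental_field y A) \<phi> (proj z) = frechet_derivative G (at z) (?M ** z)"
      if "z \<in> U \<inter> SU3" for z
    proof -
      have z: "z \<in> U" "z \<in> SU3" using that by auto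
      note fc = fundamental_field_curve [OF z(2) assms]
      show ?thesis
        using lift_has_derivative [OF *(1) z(1) *(3,4) _ fc(2,3)] fc(1)
        by (simp add: lie_derivative_def fc(5) velocity_def \<phi> DERIV_imp_deriv)
    qed
    moreover have "\<forall>k. Ck_on k (\<lambda>z. frechet_derivative G (at z) (?M ** z)) U"
      by (intro allI Ck_on_directional bounded_linear_matmul_right *(1) spec [OF *(3)])
    ultimately show "\<exists>U F. open U \<and> x \<in> U \<and> (\<forall>k. Ck_on k F U) \<and>
        (\<forall>z\<in>U \<inter> SU3. F z = lie_derivative (fundamental_field y A) \<phi> (proj z))"
      using *(1,2)
      by (intro exI [of _ U] exI [of _ "\<lambda>z. frechet_derivative G (at z) (?M ** z)"] conjI) simp_all
  qed
qed

lemma fundamental_field_at_base: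
  assumes "y \<in> SU3" "A \<in> mspace"
  shows "fundamental_field y A (proj y) = tv y A"
proof -
  note fc = fundamental_field_curve [OF assms(1) assms]
  have "ctranspose y ** (y ** A ** ctranspose y ** y) =
      ctranspose y ** (y ** (A ** (ctranspose y ** y)))"
    by (simp only: matrix_mul_assoc)
  also have "\<dots> = A"
    by (simp only: SU3_cancel SU3_left_inverse assms matrix_mul_rid)
  finally show ?thesis
    using velocity_eq_tv [OF fc(1-3)] by (simp add: fc(5) offdiag_mspace assms)
qed

text \<open>A real-linear projection of all matrices onto \<open>mspace\<close>. It extends maps
  given on \<open>mspace\<close> to the whole matrix space, where linearity and boundedness can be
  stated.\<close>

definition mproj :: "cmat3 \<Rightarrow> cmat3" where
  "mproj A = offdiag ((1/2) *\<^sub>R (A - ctranspose A))"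

lemma linear_mproj: "linear mproj"
  unfolding mproj_def
  by (rule linearI) (simp_all add: linear_add [OF linear_offdiag] linear_diff [OF linear_offdiag]
      linear_scale [OF linear_offdiag] ctranspose_linear_simps algebra_simps)

lemma bounded_linear_mproj: "bounded_linear mproj"
  using linear_mproj by (simp add: linear_conv_bounded_linear)

lemma bounded_linear_offdiag: "bounded_linear offdiag"
  using linear_offdiag by (simp add: linear_conv_bounded_linear)

lemma mproj_in_mspace: "mproj A \<in> mspace"
  by (simp add: mproj_def mspace_def offdiag_def vec_eq_iff flip: scaleR_minus_right)

lemma mproj_mspace: "A \<in> mspace \<Longrightarrow> mproj A = A"
  unfolding mproj_def by (subst (2) offdiag_mspace [symmetric])
    (simp_all add: mspace_def flip: scaleR_2)

text \<open>The curve equals its own projection by \<open>mproj\<close>, so by uniqueness its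
  derivative is fixed by \<open>mproj\<close> as well.\<close>

lemma has_vector_derivative_in_mspace:
  assumes "(f has_vector_derivative D) (at t)" "\<And>s. f s \<in> mspace"
  shows "D \<in> mspace"
proof -
  have "((\<lambda>s. mproj (f s)) has_vector_derivative mproj D) (at t)"
    by (rule bounded_linear.has_vector_derivative [OF bounded_linear_mproj assms(1)])
  then have "(f has_vector_derivative mproj D) (at t)"
    by (simp add: mproj_mspace assms(2))
  then show ?thesis
    using vector_derivative_unique_at assms(1) mproj_in_mspace by metis
qed

text \<open>A curve through \<open>x\<close> with initial velocity \<open>x ** A\<close>; no group
  law in \<open>t\<close> is claimed.\<close>

definition flow :: "cmat3 \<Rightarrow> cmat3 \<Rightarrow> real \<Rightarrow> cmat3" where
  "flow x A t = x ** curve (A$1$2) (A$2$3) (A$3$1) t"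

lemma flow:
  assumes "x \<in> SU3" "A \<in> mspace"
  shows "flow x A t \<in> SU3" "flow x A 0 = x" "(flow x A has_vector_derivative x ** A) (at 0)"
    "velocity (\<lambda>t. proj (flow x A t)) = tv x A"
  using has_vector_derivative_curve [OF assms(2)]
  by (simp_all add: flow_def [abs_def] tv_def assms SU3_mult curve_in_SU3 curve_0)

section \<open>Derivatives of vector fields and the Lie bracket in the frame\<close>

definition frame_field :: "vfield \<Rightarrow> cmat3 \<Rightarrow> cmat3" where
  "frame_field X x = hat x (X (proj x))"

definition frame_deriv :: "cmat3 \<Rightarrow> vfield \<Rightarrow> cmat3 \<Rightarrow> cmat3" where
  "frame_deriv A Y x = vector_derivative (\<lambda>t. frame_field Y (flow x A t)) (at 0)"

lemma vector_fields_tangent: "X \<in> vector_fields \<Longrightarrow> X p \<in> tangent_space p"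
  by (simp add: vector_fields_def)

lemma frame_field_in_mspace: "X \<in> vector_fields \<Longrightarrow> x \<in> SU3 \<Longrightarrow> frame_field X x \<in> mspace"
  by (simp add: frame_field_def hat_in_mspace vector_fields_tangent)

lemma tv_frame_field: "X \<in> vector_fields \<Longrightarrow> x \<in> SU3 \<Longrightarrow> tv x (frame_field X x) = X (proj x)"
  by (simp add: frame_field_def tv_hat vector_fields_tangent)

lemma frame_field_fundamental_field: "x \<in> SU3 \<Longrightarrow> A \<in> mspace \<Longrightarrow> frame_field (fundamental_field x A) x = A"
  by (simp add: frame_field_def fundamental_field_at_base hat_tv)

text \<open>The second derivative of the embedding by projections: along \<open>Y\<close>, and then
  at \<open>x\<close> along \<open>A\<close>. Its skew part is the embedding derivative of the Lie
  bracket.\<close>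

definition coord_deriv2 :: "3 \<Rightarrow> cmat3 \<Rightarrow> cmat3 \<Rightarrow> vfield \<Rightarrow> cmat3" where
  "coord_deriv2 a x A Y = (\<Sum>B\<in>Basis. tv x A (lie_derivative Y (\<lambda>p. flag_coord a p \<bullet> B)) *\<^sub>R B)"

lemma has_real_derivative_flow:
  assumes "x \<in> SU3" "A \<in> mspace" "smooth_fun \<phi>"
  shows "((\<lambda>t. \<phi> (proj (flow x A t))) has_real_derivative tv x A \<phi>) (at 0)"
  using has_derivative_dlift [OF assms(3,1) flow(1-3) [OF assms(1,2)]]
  by (simp add: tv_eq assms)

lemma coord_deriv_has_derivative:
  assumes "x \<in> SU3" "A \<in> mspace" "Y \<in> vector_fields"
  shows "((\<lambda>t. coord_deriv a (Y (proj (flow x A t)))) has_vector_derivative coord_deriv2 a x A Y) (at 0)"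
  unfolding coord_deriv_def coord_deriv2_def
proof (rule has_vector_derivative_sum)
  fix B :: cmat3
  let ?\<phi> = "\<lambda>p. flag_coord a p \<bullet> B"
  have "smooth_fun (lie_derivative Y ?\<phi>)"
    using assms(3) smooth_fun_flag_coord by (simp add: vector_fields_def)
  then have "((\<lambda>t. Y (proj (flow x A t)) ?\<phi>) has_real_derivative tv x A (lie_derivative Y ?\<phi>)) (at 0)"
    using has_real_derivative_flow [OF assms(1,2)] by (simp add: lie_derivative_def)
  then show "((\<lambda>t. Y (proj (flow x A t)) ?\<phi> *\<^sub>R B) has_vector_derivative
      tv x A (lie_derivative Y ?\<phi>) *\<^sub>R B) (at 0)"
    unfolding has_real_derivative_iff_has_vector_derivative
    by (rule bounded_linear.has_vector_derivative [OF bounded_linear_scaleR_left])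
qed

lemma matmul_diag_unit_nth: "((A :: cmat3) ** diag_unit a) $ i $ j = (if j = a then A $ i $ j else 0)"
  using exhaust_3 [of a] by (auto simp: matmul_nth diag_unit_def)

text \<open>Right multiplication by \<open>diag_unit j\<close> selects the \<open>j\<close>-th
  column. In this form \<open>hat\<close> is built from linear maps and matrix products, so it can
  be differentiated along a curve.\<close>

lemma hat_sum: "hat x v = (\<Sum>j\<in>UNIV. offdiag (ctranspose x ** coord_deriv j v ** x) ** diag_unit j)"
  by (simp add: vec_eq_iff hat_def matmul_diag_unit_nth) (simp add: offdiag_def)

lemma frame_field_has_derivative:
  assumes "x \<in> SU3" "A \<in> mspace" "Y \<in> vector_fields"
  shows "((\<lambda>t. frame_field Y (flow x A t)) has_vector_derivative frame_deriv A Y x) (at 0)"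
proof -
  let ?h = "\<lambda>j t. offdiag (ctranspose (flow x A t) ** coord_deriv j (Y (proj (flow x A t))) ** flow x A t) ** diag_unit j"
  have "\<forall>j. \<exists>D. (?h j has_vector_derivative D) (at 0)"
    by (rule allI, rule exI, (rule bounded_linear.has_vector_derivative [OF bounded_linear_matmul_left]
        bounded_linear.has_vector_derivative [OF bounded_linear_offdiag]
        bounded_linear.has_vector_derivative [OF bounded_linear_ctranspose]
        has_vector_derivative_matmul flow(3) coord_deriv_has_derivative assms)+)
  then obtain D where D: "\<forall>j. (?h j has_vector_derivative D j) (at 0)"
    by (rule choice [THEN exE])
  have "((\<lambda>t. \<Sum>j\<in>UNIV. ?h j t) has_vector_derivative (\<Sum>j\<in>UNIV. D j)) (at 0)"
    by (rule has_vector_derivative_sum) (rule spec [OF D])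
  then have "((\<lambda>t. frame_field Y (flow x A t)) has_vector_derivative (\<Sum>j\<in>UNIV. D j)) (at 0)"
    by (simp only: frame_field_def hat_sum)
  then show ?thesis
    unfolding frame_deriv_def by (metis vector_derivative_at)
qed

lemma frame_deriv_in_mspace:
  assumes "x \<in> SU3" "A \<in> mspace" "Y \<in> vector_fields"
  shows "frame_deriv A Y x \<in> mspace"
  by (rule has_vector_derivative_in_mspace [OF frame_field_has_derivative [OF assms]])
    (simp add: frame_field_in_mspace flow assms)

text \<open>Product rule applied to \<open>coord_deriv_tv\<close> along the curve: the moving frame
  contributes the double commutator of \<open>A\<close>, \<open>B\<close> and
  \<open>diag_unit a\<close>, the moving coordinates contribute the commutator of
  \<open>B'\<close>.\<close>

lemma coord_deriv2_eq:
  assumes "x \<in> SU3" "A \<in> mspace" "Y \<in> vector_fields"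
  defines "B \<equiv> frame_field Y x" and "B' \<equiv> frame_deriv A Y x"
  shows "coord_deriv2 a x A Y = x ** (A ** (B ** diag_unit a - diag_unit a ** B) - (B ** diag_unit a - diag_unit a ** B) ** A
     + (B' ** diag_unit a - diag_unit a ** B')) ** ctranspose x"
proof -
  let ?\<gamma> = "flow x A"
  let ?h = "\<lambda>t. frame_field Y (?\<gamma> t)"
  have fl: "flow x A t \<in> SU3" for t by (rule flow(1) [OF assms(1,2)])
  have "coord_deriv a (Y (proj (?\<gamma> t))) = ?\<gamma> t ** (?h t ** diag_unit a - diag_unit a ** ?h t) ** ctranspose (?\<gamma> t)" for t
    using coord_deriv_tv [OF fl [of t] frame_field_in_mspace [OF assms(3) fl [of t]], of a] tv_frame_field [OF assms(3) fl [of t]]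
    by simp
  then have "((\<lambda>t. ?\<gamma> t ** (?h t ** diag_unit a - diag_unit a ** ?h t) ** ctranspose (?\<gamma> t)) has_vector_derivative
      coord_deriv2 a x A Y) (at 0)"
    using coord_deriv_has_derivative [OF assms(1-3), of a] by simp
  moreover have "((\<lambda>t. ?\<gamma> t ** (?h t ** diag_unit a - diag_unit a ** ?h t) ** ctranspose (?\<gamma> t)) has_vector_derivative
      (?\<gamma> 0 ** (?h 0 ** diag_unit a - diag_unit a ** ?h 0)) ** ctranspose (x ** A) +
      (?\<gamma> 0 ** (B' ** diag_unit a - diag_unit a ** B') + (x ** A) ** (?h 0 ** diag_unit a - diag_unit a ** ?h 0))
        ** ctranspose (?\<gamma> 0)) (at 0)"
    unfolding B'_def
    by (intro has_vector_derivative_matmul has_vector_derivative_diff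
        bounded_linear.has_vector_derivative [OF bounded_linear_ctranspose]
        bounded_linear.has_vector_derivative [OF bounded_linear_matmul_left]
        bounded_linear.has_vector_derivative [OF bounded_linear_matmul_right]
        flow(3) frame_field_has_derivative assms(1-3))
  ultimately have "coord_deriv2 a x A Y = (?\<gamma> 0 ** (?h 0 ** diag_unit a - diag_unit a ** ?h 0)) ** ctranspose (x ** A) +
      (?\<gamma> 0 ** (B' ** diag_unit a - diag_unit a ** B') + (x ** A) ** (?h 0 ** diag_unit a - diag_unit a ** ?h 0))
        ** ctranspose (?\<gamma> 0)"
    by (rule vector_derivative_unique_at)
  moreover have "ctranspose A = - A" using assms(2) by (simp add: mspace_def)
  ultimately show ?thesis
    by (simp add: flow assms(1,2) B_def ctranspose_mult matmul_linear_simps matrix_mul_assoc)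
qed

definition bracket_m :: "cmat3 \<Rightarrow> cmat3 \<Rightarrow> cmat3" where
  "bracket_m A B = offdiag (A ** B - B ** A)"

text \<open>Only the derivatives of the coordinates \<open>flag_coord\<close> enter, so the symmetry of second derivatives
  is not needed, and neither is the tangency of the bracket.\<close>

lemma hat_lie_bracket:
  assumes "x \<in> SU3" "X \<in> vector_fields" "Y \<in> vector_fields"
  defines "A \<equiv> frame_field X x" and "B \<equiv> frame_field Y x"
  shows "hat x (lie_bracket X Y (proj x)) = bracket_m A B + frame_deriv A Y x - frame_deriv B X x"
proof -
  have A: "A \<in> mspace" "tv x A = X (proj x)" and B: "B \<in> mspace" "tv x B = Y (proj x)"
    by (simp_all add: A_def B_def frame_field_in_mspace tv_frame_field assms)
  have L: "frame_deriv A Y x \<in> mspace" "frame_deriv B X x \<in> mspace"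
    using frame_deriv_in_mspace assms A B by auto
  have "coord_deriv a (lie_bracket X Y (proj x)) = coord_deriv2 a x A Y - coord_deriv2 a x B X" for a
    by (simp add: coord_deriv_def coord_deriv2_def A B lie_bracket_def sum_subtractf scaleR_diff_left)
  \<comment> \<open>Jacobi identity: the difference of the double commutators, \<open>A\<close>
    outside \<open>B\<close> and \<open>B\<close> outside \<open>A\<close>, is the commutator of
    \<open>A ** B - B ** A\<close> with \<open>diag_unit a\<close>.\<close>
  moreover have "coord_deriv2 a x A Y - coord_deriv2 a x B X = x ** ((A ** B - B ** A + frame_deriv A Y x - frame_deriv B X x) ** diag_unit a
      - diag_unit a ** (A ** B - B ** A + frame_deriv A Y x - frame_deriv B X x)) ** ctranspose x" for a
    unfolding coord_deriv2_eq [OF assms(1) A(1) assms(3)] coord_deriv2_eq [OF assms(1) B(1) assms(2)]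
      A_def [symmetric] B_def [symmetric]
    by (simp add: matmul_linear_simps matrix_mul_assoc algebra_simps)
  ultimately have "hat x (lie_bracket X Y (proj x)) =
      offdiag (A ** B - B ** A + frame_deriv A Y x - frame_deriv B X x)"
    by (intro hat_eq_offdiag assms(1)) simp
  then show ?thesis
    using L by (simp add: bracket_m_def linear_add [OF linear_offdiag] linear_diff [OF linear_offdiag]
        offdiag_mspace)
qed

section \<open>Invariant tensors and the Levi-Civita connection\<close>

locale invariant_data =
  fixes f :: tensor11 and g :: metric and nabla :: connection
  assumes tensor: "tensor_field_11 f"
    and inv_f: "invariant_tensor f"
    and riem: "riemannian_metric g"
    and inv_g: "invariant_metric g"
    and lc: "levi_civita g nabla"
begin

definition fm :: "cmat3 \<Rightarrow> cmat3" where
  "fm A = hat (mat 1) (f (proj (mat 1)) (tv (mat 1) (mproj A)))"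

definition gm :: "cmat3 \<Rightarrow> cmat3 \<Rightarrow> real" where
  "gm A B = g (proj (mat 1)) (tv (mat 1) (mproj A)) (tv (mat 1) (mproj B))"

lemma f_tangent: "v \<in> tangent_space p \<Longrightarrow> f p v \<in> tangent_space p"
  using tensor by (simp add: tensor_field_11_def)

lemma fm_in_mspace: "fm A \<in> mspace"
  unfolding fm_def by (intro hat_in_mspace f_tangent tv_in_tangent_space mat_1_in_SU3)

lemma linear_fm: "linear fm"
proof -
  let ?o = "proj (mat 1)"
  have t: "tv (mat 1) A \<in> tangent_space ?o" for A
    by (intro tv_in_tangent_space mat_1_in_SU3)
  have add: "f ?o (tv_add v w) = tv_add (f ?o v) (f ?o w)"
    if "v \<in> tangent_space ?o" "w \<in> tangent_space ?o" for v w
    using tensor that by (simp add: tensor_field_11_def)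
  have scale: "f ?o (tv_scale c v) = tv_scale c (f ?o v)" if "v \<in> tangent_space ?o" for v c
    using tensor that by (simp add: tensor_field_11_def)
  show ?thesis
    by (rule linearI)
      (simp_all add: fm_def linear_add [OF linear_mproj] linear_scale [OF linear_mproj]
        tv_add_tv [OF mat_1_in_SU3, symmetric] tv_scale_tv [OF mat_1_in_SU3, symmetric]
        mproj_in_mspace add scale t hat_linear_simps)
qed

lemma hat_f:
  assumes "x \<in> SU3" "v \<in> tangent_space (proj x)"
  shows "hat x (f (proj x) v) = fm (hat x v)"
proof -
  obtain A where A: "A \<in> mspace" "v = tv x A"
    using tangent_space_tv [OF assms] .
  let ?w = "tv (mat 1) A"
  have w: "?w \<in> tangent_space (proj (mat 1))"
    by (intro tv_in_tangent_space mat_1_in_SU3)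
  have v: "v = push x ?w" and p: "proj x = act x (proj (mat 1))"
    by (simp_all add: A push_tv assms mat_1_in_SU3 act_proj)
  have fw: "f (proj (mat 1)) ?w = tv (mat 1) (fm A)"
    using f_tangent [OF w] by (simp add: fm_def mproj_mspace A tv_hat mat_1_in_SU3)
  have "f (proj x) v = push x (f (proj (mat 1)) ?w)"
    using inv_f assms(1) w unfolding v p invariant_tensor_def by blast
  also have "\<dots> = tv x (fm A)"
    by (simp add: fw push_tv assms mat_1_in_SU3 fm_in_mspace)
  finally show ?thesis
    by (simp add: A hat_tv assms fm_in_mspace)
qed

lemma g_eq_gm:
  assumes "x \<in> SU3" "v \<in> tangent_space (proj x)" "w \<in> tangent_space (proj x)"
  shows "g (proj x) v w = gm (hat x v) (hat x w)"
proof -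
  obtain A B where A: "A \<in> mspace" "v = tv x A" and B: "B \<in> mspace" "w = tv x B"
    using tangent_space_tv assms by metis
  have t: "tv (mat 1) C \<in> tangent_space (proj (mat 1))" for C
    by (intro tv_in_tangent_space mat_1_in_SU3)
  have "v = push x (tv (mat 1) A)" "w = push x (tv (mat 1) B)" "proj x = act x (proj (mat 1))"
    by (simp_all add: A B push_tv assms mat_1_in_SU3 act_proj)
  then have "g (proj x) v w = g (proj (mat 1)) (tv (mat 1) A) (tv (mat 1) B)"
    using inv_g assms(1) t by (simp add: invariant_metric_def)
  then show ?thesis
    by (simp add: gm_def A B hat_tv assms mproj_mspace)
qed

lemma gm_sym: "gm A B = gm B A"
  using riem tv_in_tangent_space [OF mat_1_in_SU3] by (simp add: gm_def riemannian_metric_def)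

lemma linear_gm: "linear (\<lambda>A. gm A B)"
proof -
  let ?o = "proj (mat 1)"
  have t: "tv (mat 1) A \<in> tangent_space ?o" for A
    by (intro tv_in_tangent_space mat_1_in_SU3)
  show ?thesis
    using riem t
    by (intro linearI)
      (simp_all add: gm_def linear_add [OF linear_mproj] linear_scale [OF linear_mproj]
        tv_add_tv [OF mat_1_in_SU3, symmetric] tv_scale_tv [OF mat_1_in_SU3, symmetric]
        mproj_in_mspace riemannian_metric_def)
qed

lemmas gm_linear_simps = linear_add [OF linear_gm] linear_diff [OF linear_gm] linear_scale [OF linear_gm]
  linear_neg [OF linear_gm] linear_0 [OF linear_gm]

lemma bounded_bilinear_gm: "bounded_bilinear gm"
  unfolding bilinear_conv_bounded_bilinear [symmetric] bilinear_def
  using linear_gm gm_sym by (metis (no_types, lifting) ext)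

lemma gm_pos:
  assumes "A \<in> mspace" "A \<noteq> 0"
  shows "0 < gm A A"
proof -
  have "tv (mat 1) A \<noteq> tv_zero"
    using hat_tv [OF mat_1_in_SU3 assms(1)] assms(2) hat_linear_simps(4) by metis
  then show ?thesis
    using riem tv_in_tangent_space [OF mat_1_in_SU3]
    by (simp add: gm_def mproj_mspace assms riemannian_metric_def)
qed

lemma T_max_mspace:
  assumes "s \<in> T_max" "A \<in> mspace"
  shows "ctranspose s ** A ** s \<in> mspace" "tv (mat 1) A = tv s (ctranspose s ** A ** s)"
    "proj s = proj (mat 1)"
proof -
  show "ctranspose s ** A ** s \<in> mspace"
    by (rule mspace_T_max_conj [OF assms])
  show "tv (mat 1) A = tv s (ctranspose s ** A ** s)" 
    using tv_T_max [OF mat_1_in_SU3 assms] by simp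
  show "proj s = proj (mat 1)"
    using proj_mult_T_max [OF mat_1_in_SU3 assms(1)] by simp
qed

text \<open>At the base coset there are two frames, one at the identity and one at \<open>s\<close>.
  The matrix of \<open>f\<close> is \<open>fm\<close> in both, and they differ by conjugation with
  \<open>s\<close>.\<close>

lemma fm_T_max:
  assumes "s \<in> T_max" "A \<in> mspace"
  shows "fm (ctranspose s ** A ** s) = ctranspose s ** fm A ** s"
proof -
  note sA = T_max_mspace [OF assms] and sF = T_max_mspace [OF assms(1) fm_in_mspace [of A]]
  have s: "s \<in> SU3" using assms(1) by (rule T_max_subset)
  have "fm (ctranspose s ** A ** s) = fm (hat s (tv s (ctranspose s ** A ** s)))"
    by (simp add: hat_tv s sA)
  also have "\<dots> = hat s (f (proj s) (tv s (ctranspose s ** A ** s)))"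
    by (simp add: hat_f s tv_in_tangent_space)
  also have "\<dots> = hat s (f (proj (mat 1)) (tv (mat 1) A))"
    by (simp add: sA)
  also have "f (proj (mat 1)) (tv (mat 1) A) = tv (mat 1) (fm A)"
    using f_tangent [OF tv_in_tangent_space [OF mat_1_in_SU3]]
    by (simp add: fm_def mproj_mspace assms tv_hat mat_1_in_SU3)
  also have "hat s \<dots> = ctranspose s ** fm A ** s"
    by (simp add: sF hat_tv s)
  finally show ?thesis .
qed

lemma gm_T_max:
  assumes "s \<in> T_max" "A \<in> mspace" "B \<in> mspace"
  shows "gm (ctranspose s ** A ** s) (ctranspose s ** B ** s) = gm A B"
proof -
  note sA = T_max_mspace [OF assms(1,2)] and sB = T_max_mspace [OF assms(1,3)]
  have s: "s \<in> SU3" using assms(1) by (rule T_max_subset)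
  have "gm (ctranspose s ** A ** s) (ctranspose s ** B ** s) =
      g (proj s) (tv s (ctranspose s ** A ** s)) (tv s (ctranspose s ** B ** s))"
    using sA(1) sB(1) by (subst g_eq_gm [OF s]) (simp_all add: tv_in_tangent_space hat_tv s)
  also have "\<dots> = gm A B"
    by (simp add: sA(2,3) [symmetric] sB(2) [symmetric] gm_def mproj_mspace assms)
  finally show ?thesis .
qed

lemma app_in_vector_fields: "X \<in> vector_fields \<Longrightarrow> app f X \<in> vector_fields"
  using tensor by (simp add: tensor_field_11_def)

lemma frame_field_app: "X \<in> vector_fields \<Longrightarrow> x \<in> SU3 \<Longrightarrow> frame_field (app f X) x = fm (frame_field X x)"
  by (simp add: frame_field_def app_def hat_f vector_fields_tangent)

section \<open>The Levi-Civita connection in the frame\<close>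

lemma nabla_in_vector_fields:
  "X \<in> vector_fields \<Longrightarrow> Y \<in> vector_fields \<Longrightarrow> nabla X Y \<in> vector_fields"
  using lc by (simp add: levi_civita_def affine_connection_def)

text \<open>The connection map of Nomizu. It is defined from two fields; \<open>koszul\<close> shows
  that it depends on their values at \<open>x\<close> alone.\<close>

definition nomizu :: "vfield \<Rightarrow> vfield \<Rightarrow> cmat3 \<Rightarrow> cmat3" where
  "nomizu X Y x = frame_field (nabla X Y) x - frame_deriv (frame_field X x) Y x"

lemma nomizu_in_mspace:
  assumes "x \<in> SU3" "X \<in> vector_fields" "Y \<in> vector_fields"
  shows "nomizu X Y x \<in> mspace"
  unfolding nomizu_def
  by (intro subspace_diff subspace_mspace frame_field_in_mspace frame_deriv_in_mspace nabla_in_vector_fields assms)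

lemma nomizu_torsion_free:
  assumes "x \<in> SU3" "X \<in> vector_fields" "Y \<in> vector_fields"
  shows "nomizu X Y x - nomizu Y X x = bracket_m (frame_field X x) (frame_field Y x)"
proof -
  have "vf_diff (nabla X Y) (nabla Y X) (proj x) = lie_bracket X Y (proj x)"
    using lc assms by (simp add: levi_civita_def)
  then have "hat x (tv_diff (nabla X Y (proj x)) (nabla Y X (proj x))) =
      bracket_m (frame_field X x) (frame_field Y x) + frame_deriv (frame_field X x) Y x - frame_deriv (frame_field Y x) X x"
    using hat_lie_bracket [OF assms] by (simp add: vf_diff_def)
  then show ?thesis
    by (simp add: nomizu_def frame_field_def hat_linear_simps algebra_simps)
qed

text \<open>The metric has constant coefficients, so \<open>X\<close> applied to the inner product
  of \<open>Y\<close> and \<open>Z\<close> yields the frame derivatives by the product rule.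
  Subtracting these from metric compatibility leaves the \<open>nomizu\<close> terms.\<close>

lemma nomizu_skew:
  assumes "x \<in> SU3" "X \<in> vector_fields" "Y \<in> vector_fields" "Z \<in> vector_fields"
  shows "gm (nomizu X Y x) (frame_field Z x) + gm (frame_field Y x) (nomizu X Z x) = 0"
proof -
  define A where "A = frame_field X x"
  have A: "A \<in> mspace" "tv x A = X (proj x)"
    by (simp_all add: A_def frame_field_in_mspace tv_frame_field assms)
  let ?\<phi> = "\<lambda>q. g q (Y q) (Z q)"
  have "smooth_fun ?\<phi>"
    using riem assms(3,4) by (simp add: riemannian_metric_def)
  then have "((\<lambda>t. ?\<phi> (proj (flow x A t))) has_real_derivative X (proj x) ?\<phi>) (at 0)"
    using has_real_derivative_flow [OF assms(1) A(1)] by (simp add: A)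
  moreover have "?\<phi> (proj (flow x A t)) = gm (frame_field Y (flow x A t)) (frame_field Z (flow x A t))" for t
    using g_eq_gm flow(1) [OF assms(1) A(1)] vector_fields_tangent assms by (simp add: frame_field_def)
  ultimately have 1: "((\<lambda>t. gm (frame_field Y (flow x A t)) (frame_field Z (flow x A t))) has_vector_derivative
      X (proj x) ?\<phi>) (at 0)"
    by (simp add: has_real_derivative_iff_has_vector_derivative)
  have 2: "((\<lambda>t. gm (frame_field Y (flow x A t)) (frame_field Z (flow x A t))) has_vector_derivative
      gm (frame_field Y (flow x A 0)) (frame_deriv A Z x) + gm (frame_deriv A Y x) (frame_field Z (flow x A 0))) (at 0)"
    by (intro bounded_bilinear.has_vector_derivative [OF bounded_bilinear_gm] frame_field_has_derivative assms A)
  have "X (proj x) ?\<phi> = gm (frame_field Y x) (frame_deriv A Z x) + gm (frame_deriv A Y x) (frame_field Z x)"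
    using vector_derivative_unique_at [OF 1 2] by (simp only: flow(2) [OF assms(1) A(1)])
  moreover have "X (proj x) ?\<phi> = g (proj x) (nabla X Y (proj x)) (Z (proj x)) +
      g (proj x) (Y (proj x)) (nabla X Z (proj x))"
    using lc assms by (simp add: levi_civita_def lie_derivative_def)
  moreover have "\<dots> = gm (frame_field (nabla X Y) x) (frame_field Z x) + gm (frame_field Y x) (frame_field (nabla X Z) x)"
    using g_eq_gm assms vector_fields_tangent nabla_in_vector_fields by (simp add: frame_field_def)
  ultimately show ?thesis
    by (simp add: nomizu_def A_def gm_linear_simps gm_sym [of "frame_field Y x"])
qed

text \<open>The usual cyclic combination of three skewness and three torsion relations. The frame
  derivatives are already absorbed in \<open>nomizu\<close>, so three bracket terms remain.\<close>

lemma koszul: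
  assumes "x \<in> SU3" "X \<in> vector_fields" "Y \<in> vector_fields" "C \<in> mspace"
  defines "A \<equiv> frame_field X x" and "B \<equiv> frame_field Y x"
  shows "2 * gm (nomizu X Y x) C = gm (bracket_m A B) C - gm (bracket_m B C) A + gm (bracket_m C A) B"
proof -
  define Z where "Z = fundamental_field x C"
  have Z: "Z \<in> vector_fields" "frame_field Z x = C"
    by (simp_all add: Z_def fundamental_field_in_vector_fields frame_field_fundamental_field assms)
  have tor: "nomizu X Y x = nomizu Y X x + bracket_m A B" "nomizu Z X x = nomizu X Z x + bracket_m C A" "nomizu Y Z x = nomizu Z Y x + bracket_m B C"
    using nomizu_torsion_free [OF assms(1) assms(2,3)] nomizu_torsion_free [OF assms(1) Z(1) assms(2)]
      nomizu_torsion_free [OF assms(1) assms(3) Z(1)]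
    by (simp_all add: A_def B_def Z algebra_simps)
  have "gm (nomizu X Y x) C + gm B (nomizu X Z x) = 0" "gm (nomizu Y Z x) A + gm C (nomizu Y X x) = 0"
    "gm (nomizu Z X x) B + gm A (nomizu Z Y x) = 0"
    using nomizu_skew [OF assms(1-3) Z(1)] nomizu_skew [OF assms(1,3) Z(1) assms(2)]
      nomizu_skew [OF assms(1) Z(1) assms(2,3)]
    by (simp_all add: A_def B_def Z)
  then show ?thesis
    unfolding tor by (simp add: gm_linear_simps gm_sym [of A] gm_sym [of B "nomizu X Z x"] gm_sym [of C])
qed

lemma frame_deriv_app:
  assumes "x \<in> SU3" "A \<in> mspace" "Y \<in> vector_fields"
  shows "frame_deriv A (app f Y) x = fm (frame_deriv A Y x)"
proof -
  have "((\<lambda>t. fm (frame_field Y (flow x A t))) has_vector_derivative fm (frame_deriv A Y x)) (at 0)"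
    using bounded_linear.has_vector_derivative [OF _ frame_field_has_derivative [OF assms], of fm] linear_fm
    by (simp add: linear_conv_bounded_linear)
  then have "((\<lambda>t. frame_field (app f Y) (flow x A t)) has_vector_derivative fm (frame_deriv A Y x)) (at 0)"
    by (simp add: frame_field_app assms flow)
  then show ?thesis
    unfolding frame_deriv_def by (rule vector_derivative_at)
qed

text \<open>A constant linear map commutes with the frame derivative, so the derivative terms
  cancel.\<close>

lemma hat_cov:
  assumes "x \<in> SU3" "X \<in> vector_fields" "Y \<in> vector_fields"
  shows "hat x (cov nabla f X Y (proj x)) = nomizu X (app f Y) x - fm (nomizu X Y x)"
proof -
  have "hat x (cov nabla f X Y (proj x)) = frame_field (nabla X (app f Y)) x - fm (frame_field (nabla X Y) x)"
    using frame_field_app [OF nabla_in_vector_fields [OF assms(2,3)] assms(1)]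
    by (simp add: cov_def vf_diff_def hat_linear_simps frame_field_def)
  then show ?thesis
    by (simp add: nomizu_def frame_deriv_app frame_field_in_mspace assms linear_diff [OF linear_fm])
qed

lemma cov_tangent:
  assumes "X \<in> vector_fields" "Y \<in> vector_fields"
  shows "cov nabla f X Y p \<in> tangent_space p"
proof -
  have "nabla X (app f Y) p \<in> tangent_space p" "app f (nabla X Y) p \<in> tangent_space p"
    by (intro vector_fields_tangent nabla_in_vector_fields app_in_vector_fields assms)+
  then show ?thesis
    unfolding cov_def vf_diff_def by (rule tangent_space_closed(2))
qed

end

section \<open>Root coordinates\<close>

lemma mvec_nth [simp]: "mvec u v w $ 1 $ 2 = u" "mvec u v w $ 2 $ 3 = v" "mvec u v w $ 3 $ 1 = w"
  by (simp_all add: mvec_def)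

lemma mvec_in_mspace [simp]: "mvec u v w \<in> mspace"
  by (auto simp: mspace_mvec)

lemma mvec_eq_iff: "mvec u v w = mvec u' v' w' \<longleftrightarrow> u = u' \<and> v = v' \<and> w = w'"
  by (metis mvec_nth)

lemma mvec_linear_simps:
  "mvec u v w + mvec u' v' w' = mvec (u + u') (v + v') (w + w')"
  "mvec u v w - mvec u' v' w' = mvec (u - u') (v - v') (w - w')"
  "- mvec u v w = mvec (- u) (- v) (- w)"
  "c *\<^sub>R mvec u v w = mvec (c *\<^sub>R u) (c *\<^sub>R v) (c *\<^sub>R w)"
  by (simp_all add: mvec_def cmat3_eq_iff)

lemma mvec_zero: "mvec 0 0 0 = 0"
  by (simp add: mvec_def cmat3_eq_iff)

lemma mvec_eq_zero_iff: "mvec u v w = 0 \<longleftrightarrow> u = 0 \<and> v = 0 \<and> w = 0"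
  by (metis mvec_zero mvec_eq_iff)

text \<open>Taking the entry (3,1) in place of (1,3) makes the formula cyclic: each component is the
  conjugate of a minor of the other two.\<close>

lemma bracket_m_mvec:
  "bracket_m (mvec u v w) (mvec u' v' w') = mvec (cnj (w * v' - v * w')) (cnj (u * w' - w * u')) (cnj (v * u' - u * v'))"
  by (simp add: bracket_m_def offdiag_def cmat3_eq_iff matmul_nth mvec_def)

definition diag3 :: "complex \<Rightarrow> complex \<Rightarrow> complex \<Rightarrow> cmat3" where
  "diag3 a b c = mat3 a 0 0 0 b 0 0 0 c"

text \<open>The torus acts on the three planes by the characters \<open>cnj a * b\<close>,
  \<open>cnj b * c\<close> and \<open>cnj c * a\<close>.\<close>

lemma diag3_conj_mvec:
  "ctranspose (diag3 a b c) ** mvec u v w ** diag3 a b c = mvec (cnj a * u * b) (cnj b * v * c) (cnj c * w * a)"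
  by (simp add: diag3_def mvec_def cmat3_eq_iff matmul_nth)

lemma diag3_in_T_max:
  assumes "cnj a * a = 1" "cnj b * b = 1" "cnj c * c = 1" "a * b * c = 1"
  shows "diag3 a b c \<in> T_max"
  using assms by (simp add: diag3_def T_max_def SU3_def det_3 cmat3_eq_iff matmul_nth mat_1_nth forall_3)

lemma linear_commutes_imaginary:
  fixes h :: "complex \<Rightarrow> complex"
  assumes "linear h" "h \<i> = \<i> * h 1"
  shows "h u = h 1 * u"
proof -
  have "h (Re u *\<^sub>R 1 + Im u *\<^sub>R \<i>) = Re u *\<^sub>R h 1 + Im u *\<^sub>R h \<i>"
    by (simp only: linear_add [OF assms(1)] linear_scale [OF assms(1)])
  moreover have "Re u *\<^sub>R 1 + Im u *\<^sub>R \<i> = u"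
    by (simp add: complex_eq_iff)
  ultimately have "h u = Re u *\<^sub>R h 1 + Im u *\<^sub>R (\<i> * h 1)"
    by (simp only: assms(2))
  then show ?thesis
    by (simp add: complex_eq_iff algebra_simps)
qed

text \<open>Rotation by \<i> gives equal values at (1,1) and (\<i>,\<i>), and turns the mixed value
  into its negative.\<close>

lemma invariant_bilinear_complex:
  fixes q :: "complex \<Rightarrow> complex \<Rightarrow> real"
  assumes "\<And>v. linear (\<lambda>u. q u v)" "\<And>u v. q u v = q v u" "\<And>u v. q (\<i> * u) (\<i> * v) = q u v"
  shows "q u v = q 1 1 * Re (u * cnj v)"
proof -
  have lin: "q (a + b) v = q a v + q b v" "q (r *\<^sub>R a) v = r * q a v" for a b v r
    using linear_add [OF assms(1)] linear_scale [OF assms(1)] by auto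
  have ii: "q \<i> \<i> = q 1 1"
    using assms(3) [of 1 1] by simp
  have "q \<i> (- 1) = q 1 \<i>"
    using assms(3) [of 1 \<i>] by simp
  moreover have "q \<i> (- 1) = - q \<i> 1"
    using lin(2) [of "- 1" 1 \<i>] assms(2) by simp
  ultimately have 1: "q 1 \<i> = 0" "q \<i> 1 = 0"
    using assms(2) [of 1 \<i>] by simp_all
  have ex: "z = Re z *\<^sub>R 1 + Im z *\<^sub>R \<i>" for z
    by (simp add: complex_eq_iff)
  have "q u v = Re u * q 1 v + Im u * q \<i> v"
    by (subst ex [of u]) (simp only: lin)
  also have "q 1 v = Re v * q 1 1"
    by (subst assms(2), subst ex [of v]) (simp only: lin 1 mult_zero_right add_0_right)
  also have "q \<i> v = Im v * q 1 1"
    by (subst assms(2), subst ex [of v]) (simp only: lin 1 ii mult_zero_right add_0)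
  finally show ?thesis
    by (simp add: algebra_simps)
qed

text \<open>Testing the Koszul formula with 1 and with \<i> gives real and imaginary part
  separately; the opposite sign of the latter is the conjugation.\<close>

lemma cnj_eqI:
  fixes p a b :: complex and l m n :: real
  assumes "0 < l" "2 * l * Re p = m * Re a + n * Re b" "2 * l * Im p = - m * Im a - n * Im b"
  shows "p = cnj (complex_of_real (m / (2 * l)) * a + complex_of_real (n / (2 * l)) * b)"
proof -
  have "Re p = (m * Re a + n * Re b) / (2 * l)" "Im p = (- m * Im a - n * Im b) / (2 * l)"
    using assms by (simp_all add: field_simps)
  then show ?thesis
    using assms(1) by (simp add: complex_eq_iff field_simps)
qed

section \<open>Invariant tensors and connection coefficients on the root planes\<close>

context invariant_data
begin

definition mu1 :: complex where "mu1 = fm (mvec 1 0 0) $ 1 $ 2"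
definition mu2 :: complex where "mu2 = fm (mvec 0 1 0) $ 2 $ 3"
definition mu3 :: complex where "mu3 = fm (mvec 0 0 1) $ 3 $ 1"

lemma fm_diag3:
  assumes "cnj a * a = 1" "cnj b * b = 1" "cnj c * c = 1" "a * b * c = 1"
    and "fm (mvec u v w) = mvec u' v' w'"
  shows "fm (mvec (cnj a * u * b) (cnj b * v * c) (cnj c * w * a)) =
    mvec (cnj a * u' * b) (cnj b * v' * c) (cnj c * w' * a)"
  using fm_T_max [OF diag3_in_T_max [OF assms(1-4)], of "mvec u v w"]
  by (simp add: diag3_conj_mvec assms(5))

lemma fm_mvec: "fm (mvec u v w) = mvec (mu1 * u) (mu2 * v) (mu3 * w)"
proof -
  have ex: "\<exists>u' v' w'. fm A = mvec u' v' w'" for A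
    using fm_in_mspace [of A] by (simp add: mspace_mvec)
  have add: "fm (mvec u v w) = fm (mvec u 0 0) + fm (mvec 0 v 0) + fm (mvec 0 0 w)"
    by (simp add: linear_add [OF linear_fm, symmetric] mvec_linear_simps)
  have F1: "fm (mvec u 0 0) = mvec (fm (mvec u 0 0) $ 1 $ 2) 0 0" for u
  proof -
    obtain u' v' w' where *: "fm (mvec u 0 0) = mvec u' v' w'" using ex by blast
    show ?thesis
      \<comment> \<open>The torus element diag(-1,-1,1) is 1 on the first plane and -1 on the two
        others, so \<open>fm\<close> preserves the first plane. The two other planes use the
        corresponding sign matrices.\<close>
      using fm_diag3 [OF _ _ _ _ *, of "- 1" "- 1" 1] * by (simp add: mvec_eq_iff)
  qed
  have F2: "fm (mvec 0 u 0) = mvec 0 (fm (mvec 0 u 0) $ 2 $ 3) 0" for u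
  proof -
    obtain u' v' w' where *: "fm (mvec 0 u 0) = mvec u' v' w'" using ex by blast
    show ?thesis
      using fm_diag3 [OF _ _ _ _ *, of 1 "- 1" "- 1"] * by (simp add: mvec_eq_iff)
  qed
  have F3: "fm (mvec 0 0 u) = mvec 0 0 (fm (mvec 0 0 u) $ 3 $ 1)" for u
  proof -
    obtain u' v' w' where *: "fm (mvec 0 0 u) = mvec u' v' w'" using ex by blast
    show ?thesis
      using fm_diag3 [OF _ _ _ _ *, of "- 1" 1 "- 1"] * by (simp add: mvec_eq_iff)
  qed
  have lin: "linear (\<lambda>u. fm (mvec u 0 0) $ 1 $ 2)" "linear (\<lambda>u. fm (mvec 0 u 0) $ 2 $ 3)"
    "linear (\<lambda>u. fm (mvec 0 0 u) $ 3 $ 1)"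
    by (rule linearI; simp only: linear_add [OF linear_fm, symmetric] linear_scale [OF linear_fm, symmetric]
        mvec_linear_simps vector_add_component [symmetric] vector_scaleR_component [symmetric]
        add_0 scaleR_zero_right)+
  have "fm (mvec \<i> 0 0) $ 1 $ 2 = \<i> * fm (mvec 1 0 0) $ 1 $ 2"
    \<comment> \<open>The element diag(1,\<i>,-\<i>) has determinant 1 and multiplies the first
      plane by \<i>.\<close>
    using fm_diag3 [OF _ _ _ _ F1, of 1 \<i> "- \<i>" 1] by simp
  then have 1: "fm (mvec u 0 0) $ 1 $ 2 = mu1 * u" for u
    unfolding mu1_def by (rule linear_commutes_imaginary [OF lin(1)])
  have "fm (mvec 0 \<i> 0) $ 2 $ 3 = \<i> * fm (mvec 0 1 0) $ 2 $ 3"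
    using fm_diag3 [OF _ _ _ _ F2, of "- \<i>" 1 \<i> 1] by simp
  then have 2: "fm (mvec 0 u 0) $ 2 $ 3 = mu2 * u" for u
    unfolding mu2_def by (rule linear_commutes_imaginary [OF lin(2)])
  have "fm (mvec 0 0 \<i>) $ 3 $ 1 = \<i> * fm (mvec 0 0 1) $ 3 $ 1"
    using fm_diag3 [OF _ _ _ _ F3, of \<i> "- \<i>" 1 1] by simp
  then have 3: "fm (mvec 0 0 u) $ 3 $ 1 = mu3 * u" for u
    unfolding mu3_def by (rule linear_commutes_imaginary [OF lin(3)])
  show ?thesis
    unfolding add by (subst F1, subst F2, subst F3) (simp add: 1 2 3 mvec_linear_simps)
qed

definition l1 :: real where "l1 = gm (mvec 1 0 0) (mvec 1 0 0)"
definition l2 :: real where "l2 = gm (mvec 0 1 0) (mvec 0 1 0)"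
definition l3 :: real where "l3 = gm (mvec 0 0 1) (mvec 0 0 1)"

lemma l_pos: "0 < l1" "0 < l2" "0 < l3"
  unfolding l1_def l2_def l3_def by (rule gm_pos; simp add: mvec_eq_zero_iff)+

lemma gm_diag3:
  assumes "cnj a * a = 1" "cnj b * b = 1" "cnj c * c = 1" "a * b * c = 1"
  shows "gm (mvec (cnj a * u * b) (cnj b * v * c) (cnj c * w * a))
      (mvec (cnj a * u' * b) (cnj b * v' * c) (cnj c * w' * a)) = gm (mvec u v w) (mvec u' v' w')"
  using gm_T_max [OF diag3_in_T_max [OF assms(1-4)], of "mvec u v w" "mvec u' v' w'"]
  by (simp add: diag3_conj_mvec)

lemma gm_mvec:
  "gm (mvec u v w) (mvec u' v' w') = l1 * Re (u * cnj u') + l2 * Re (v * cnj v') + l3 * Re (w * cnj w')"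
proof -
  have split: "mvec u v w = mvec u 0 0 + mvec 0 v 0 + mvec 0 0 w" for u v w
    by (simp add: mvec_linear_simps)
  have neg: "gm A (- B) = - gm A B" for A B
    using gm_linear_simps(4) gm_sym by metis
  \<comment> \<open>A sign matrix fixes one of the two planes and negates the other, so each mixed
    value equals its own negative.\<close>
  have "gm (mvec u 0 0) (mvec 0 v' 0) = gm (mvec u 0 0) (- mvec 0 v' 0)"
    "gm (mvec u 0 0) (mvec 0 0 w') = gm (mvec u 0 0) (- mvec 0 0 w')"
    "gm (mvec 0 v 0) (mvec 0 0 w') = gm (mvec 0 v 0) (- mvec 0 0 w')" for u v v' w'
    using gm_diag3 [of "- 1" "- 1" 1 u 0 0 0 v' 0] gm_diag3 [of "- 1" "- 1" 1 u 0 0 0 0 w']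
      gm_diag3 [of 1 "- 1" "- 1" 0 v 0 0 0 w']
    by (simp_all add: mvec_linear_simps)
  then have orth: "gm (mvec u 0 0) (mvec 0 v' 0) = 0" "gm (mvec u 0 0) (mvec 0 0 w') = 0"
    "gm (mvec 0 v 0) (mvec 0 0 w') = 0" for u v v' w'
    unfolding neg by (simp_all add: eq_neg_iff_add_eq_0)
  have lin: "linear (\<lambda>u. gm (mvec u 0 0) B)" "linear (\<lambda>u. gm (mvec 0 u 0) B)"
    "linear (\<lambda>u. gm (mvec 0 0 u) B)" for B
    by (rule linearI; simp only: gm_linear_simps [symmetric] mvec_linear_simps add_0 scaleR_zero_right)+
  have 1: "gm (mvec u 0 0) (mvec u' 0 0) = l1 * Re (u * cnj u')"
    unfolding l1_def
    by (rule invariant_bilinear_complex [OF lin(1) gm_sym])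
      (use gm_diag3 [of 1 \<i> "- \<i>" _ 0 0 _ 0 0] in \<open>simp add: mult.commute\<close>)
  have 2: "gm (mvec 0 v 0) (mvec 0 v' 0) = l2 * Re (v * cnj v')"
    unfolding l2_def
    by (rule invariant_bilinear_complex [OF lin(2) gm_sym])
      (use gm_diag3 [of "- \<i>" 1 \<i> 0 _ 0 0 _ 0] in \<open>simp add: mult.commute\<close>)
  have 3: "gm (mvec 0 0 w) (mvec 0 0 w') = l3 * Re (w * cnj w')"
    unfolding l3_def
    by (rule invariant_bilinear_complex [OF lin(3) gm_sym])
      (use gm_diag3 [of \<i> "- \<i>" 1 0 0 _ 0 0 _] in \<open>simp add: mult.commute\<close>)
  have addr: "gm A (B + C) = gm A B + gm A C" for A B C
    using gm_linear_simps(1) gm_sym by metis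
  have orth': "gm (mvec 0 v' 0) (mvec u 0 0) = 0" "gm (mvec 0 0 w') (mvec u 0 0) = 0"
    "gm (mvec 0 0 w') (mvec 0 v 0) = 0" for u v v' w'
    using orth gm_sym by metis+
  show ?thesis
    unfolding split [of u v w] split [of u' v' w'] gm_linear_simps(1) addr 1 2 3 orth orth'
    by simp
qed

text \<open>The Koszul formula divided by \<open>2 * l1\<close>. The difference
  \<open>d1 - c1\<close> is 1, the coefficient of the bracket; the sum \<open>c1 + d1\<close> is
  \<open>(l2 - l3) / l1\<close>. The other pairs are its cyclic shifts.\<close>

definition c1 :: real where "c1 = (l2 - l1 - l3) / (2 * l1)"
definition d1 :: real where "d1 = (l1 + l2 - l3) / (2 * l1)"
definition c2 :: real where "c2 = (l3 - l2 - l1) / (2 * l2)"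
definition d2 :: real where "d2 = (l2 + l3 - l1) / (2 * l2)"
definition c3 :: real where "c3 = (l1 - l3 - l2) / (2 * l3)"
definition d3 :: real where "d3 = (l3 + l1 - l2) / (2 * l3)"

lemma nomizu_mvec:
  fixes u v w u' v' w' :: complex
  assumes "x \<in> SU3" "X \<in> vector_fields" "Y \<in> vector_fields"
    and XY: "frame_field X x = mvec u v w" "frame_field Y x = mvec u' v' w'"
  shows "nomizu X Y x = mvec (cnj (c1 * v * w' + d1 * w * v')) (cnj (c2 * w * u' + d2 * u * w'))
    (cnj (c3 * u * v' + d3 * v * u'))"
proof -
  obtain p q r where nomizu: "nomizu X Y x = mvec p q r"
    using nomizu_in_mspace [OF assms(1-3)] by (auto simp: mspace_mvec)
  note K = koszul [OF assms(1-3) mvec_in_mspace, unfolded XY nomizu bracket_m_mvec gm_mvec]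
  have "2 * l1 * Re p = (l2 - l1 - l3) * Re (v * w') + (l1 + l2 - l3) * Re (w * v')"
    using K [of 1 0 0] by (simp add: algebra_simps)
  moreover have "2 * l1 * Im p = - (l2 - l1 - l3) * Im (v * w') - (l1 + l2 - l3) * Im (w * v')"
    using K [of \<i> 0 0] by (simp add: algebra_simps)
  ultimately have p: "p = cnj (c1 * v * w' + d1 * w * v')"
    unfolding c1_def d1_def mult.assoc [of "complex_of_real _"] by (rule cnj_eqI [OF l_pos(1)])
  have "2 * l2 * Re q = (l3 - l2 - l1) * Re (w * u') + (l2 + l3 - l1) * Re (u * w')"
    using K [of 0 1 0] by (simp add: algebra_simps)
  moreover have "2 * l2 * Im q = - (l3 - l2 - l1) * Im (w * u') - (l2 + l3 - l1) * Im (u * w')"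
    using K [of 0 \<i> 0] by (simp add: algebra_simps)
  ultimately have q: "q = cnj (c2 * w * u' + d2 * u * w')"
    unfolding c2_def d2_def mult.assoc [of "complex_of_real _"] by (rule cnj_eqI [OF l_pos(2)])
  have "2 * l3 * Re r = (l1 - l3 - l2) * Re (u * v') + (l3 + l1 - l2) * Re (v * u')"
    using K [of 0 0 1] by (simp add: algebra_simps)
  moreover have "2 * l3 * Im r = - (l1 - l3 - l2) * Im (u * v') - (l3 + l1 - l2) * Im (v * u')"
    using K [of 0 0 \<i>] by (simp add: algebra_simps)
  ultimately have r: "r = cnj (c3 * u * v' + d3 * v * u')"
    unfolding c3_def d3_def mult.assoc [of "complex_of_real _"] by (rule cnj_eqI [OF l_pos(3)])
  show ?thesis
    by (simp only: nomizu p q r)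
qed

section \<open>The composition tensor in root coordinates\<close>

abbreviation "CT \<equiv> composition_tensor nabla f"

text \<open>\<open>hat\<close> separates tangent vectors, but not arbitrary functionals; hence the
  tangency condition.\<close>

lemma vf_zero_iff:
  assumes "\<And>p. V p \<in> tangent_space p"
  shows "V = vf_zero \<longleftrightarrow> (\<forall>x\<in>SU3. hat x (V (proj x)) = 0)"
proof
  assume *: "\<forall>x\<in>SU3. hat x (V (proj x)) = 0"
  show "V = vf_zero"
  proof
    fix p
    obtain x where x: "x \<in> SU3" "p = proj x" by (rule flag_cases)
    have "hat x (V (proj x)) = hat x tv_zero"
      using * x(1) by (simp add: hat_linear_simps)
    then show "V p = vf_zero p"
      using hat_inject [OF x(1) assms tangent_space_closed(4) [OF assms assms]]
      by (simp add: x(2) vf_zero_def)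
  qed
qed (simp add: vf_zero_def hat_linear_simps)

lemma CT_eq: "CT X Y p = tv_scale (1 / 4)
    (f p (tv_diff (cov nabla f (app f X) (app f Y) p)
      (cov nabla f (app f (app f X)) (app f (app f Y)) p)))"
  by (simp add: composition_tensor_def vf_scale_def vf_diff_def app_def)

lemma cov_diff_tangent:
  assumes "X \<in> vector_fields" "Y \<in> vector_fields"
  shows "tv_diff (cov nabla f (app f X) (app f Y) p)
    (cov nabla f (app f (app f X)) (app f (app f Y)) p) \<in> tangent_space p"
  by (intro tangent_space_closed(2) cov_tangent app_in_vector_fields assms)

lemma CT_tangent:
  assumes "X \<in> vector_fields" "Y \<in> vector_fields"
  shows "CT X Y p \<in> tangent_space p"
  unfolding CT_eq using tangent_space_closed(3) f_tangent cov_diff_tangent [OF assms] by blast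

lemma hat_CT:
  assumes "x \<in> SU3" "X \<in> vector_fields" "Y \<in> vector_fields"
  shows "hat x (CT X Y (proj x)) = (1 / 4) *\<^sub>R
    fm (hat x (cov nabla f (app f X) (app f Y) (proj x)) -
       hat x (cov nabla f (app f (app f X)) (app f (app f Y)) (proj x)))"
  by (simp add: CT_eq hat_linear_simps hat_f cov_diff_tangent assms)

text \<open>The condition that permits \<open>- mu1 * cnj z = cnj (mu1 * z)\<close>, which produces
  the sums of scalars in \<open>hat_cov_mvec\<close>.\<close>

definition imaginary :: bool where
  "imaginary \<longleftrightarrow> cnj mu1 = - mu1 \<and> cnj mu2 = - mu2 \<and> cnj mu3 = - mu3"

lemma hat_cov_mvec:
  fixes u v w u' v' w' :: complex
  assumes imaginary "x \<in> SU3" "X \<in> vector_fields" "Y \<in> vector_fields"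
    and XY: "frame_field X x = mvec u v w" "frame_field Y x = mvec u' v' w'"
  shows "hat x (cov nabla f X Y (proj x)) = mvec
    (cnj (c1 * (mu1 + mu3) * v * w' + d1 * (mu1 + mu2) * w * v'))
    (cnj (c2 * (mu2 + mu1) * w * u' + d2 * (mu2 + mu3) * u * w'))
    (cnj (c3 * (mu3 + mu2) * u * v' + d3 * (mu3 + mu1) * v * u'))"
proof -
  have fY: "frame_field (app f Y) x = mvec (mu1 * u') (mu2 * v') (mu3 * w')"
    by (simp add: frame_field_app assms fm_mvec)
  show ?thesis
    using assms(1)
    by (simp add: hat_cov [OF assms(2-4)] nomizu_mvec [OF assms(2-4) XY] fm_mvec mvec_linear_simps imaginary_def
        nomizu_mvec [OF assms(2,3) app_in_vector_fields [OF assms(4)] XY(1) fY] mvec_eq_iff algebra_simps)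
qed

lemma frame_field_cases:
  assumes "X \<in> vector_fields" "x \<in> SU3"
  obtains u v w where "frame_field X x = mvec u v w"
  using frame_field_in_mspace [OF assms] by (auto simp: mspace_mvec)

lemma frame_field_app_mvec:
  assumes "X \<in> vector_fields" "x \<in> SU3" "frame_field X x = mvec u v w"
  shows "frame_field (app f X) x = mvec (mu1 * u) (mu2 * v) (mu3 * w)"
  using assms by (simp add: frame_field_app fm_mvec)

text \<open>In the first component, applying \<open>f\<close> to both arguments multiplies each
  product by \<open>mu2 * mu3\<close>, applying it twice by the square; the outer \<open>mu1\<close>
  is the final \<open>f\<close>.\<close>

lemma hat_CT_mvec:
  fixes u v w u' v' w' :: complex
  assumes imaginary "x \<in> SU3" "X \<in> vector_fields" "Y \<in> vector_fields"
    and XY: "frame_field X x = mvec u v w" "frame_field Y x = mvec u' v' w'"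
  shows "4 *\<^sub>R hat x (CT X Y (proj x)) = mvec
    (mu1 * cnj ((mu2 * mu3 - (mu2 * mu3)\<^sup>2) * (c1 * (mu1 + mu3) * v * w' + d1 * (mu1 + mu2) * w * v')))
    (mu2 * cnj ((mu3 * mu1 - (mu3 * mu1)\<^sup>2) * (c2 * (mu2 + mu1) * w * u' + d2 * (mu2 + mu3) * u * w')))
    (mu3 * cnj ((mu1 * mu2 - (mu1 * mu2)\<^sup>2) * (c3 * (mu3 + mu2) * u * v' + d3 * (mu3 + mu1) * v * u')))"
proof -
  note f1 = app_in_vector_fields [OF assms(3)] app_in_vector_fields [OF assms(4)]
  note f2 = app_in_vector_fields [OF f1(1)] app_in_vector_fields [OF f1(2)]
  note h1 = frame_field_app_mvec [OF assms(3,2) XY(1)] frame_field_app_mvec [OF assms(4,2) XY(2)]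
  note h2 = frame_field_app_mvec [OF f1(1) assms(2) h1(1)] frame_field_app_mvec [OF f1(2) assms(2) h1(2)]
  show ?thesis
    unfolding hat_CT [OF assms(2-4)] hat_cov_mvec [OF assms(1,2) f1 h1] hat_cov_mvec [OF assms(1,2) f2 h2]
    by (simp add: mvec_linear_simps fm_mvec mvec_eq_iff) (simp add: algebra_simps power2_eq_square)
qed

section \<open>The classes of f-structures\<close>

lemma f_structure_mu:
  assumes "f_structure f"
  shows "mu1 \<in> {0, \<i>, - \<i>}" "mu2 \<in> {0, \<i>, - \<i>}" "mu3 \<in> {0, \<i>, - \<i>}" imaginary
proof -
  let ?o = "proj (mat 1)" and ?v = "tv (mat 1) (mvec 1 1 1)"
  have v: "?v \<in> tangent_space ?o"
    by (intro tv_in_tangent_space mat_1_in_SU3)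
  have "hat (mat 1) (tv_add (f ?o (f ?o (f ?o ?v))) (f ?o ?v)) = 0"
    using assms v by (simp add: f_structure_def hat_linear_simps)
  then have "fm (fm (fm (mvec 1 1 1))) + fm (mvec 1 1 1) = 0"
    by (simp add: hat_linear_simps hat_f mat_1_in_SU3 f_tangent v hat_tv)
  then have *: "mu1 * (mu1 * mu1) + mu1 = 0" "mu2 * (mu2 * mu2) + mu2 = 0" "mu3 * (mu3 * mu3) + mu3 = 0"
    by (simp_all add: fm_mvec mvec_linear_simps mvec_eq_zero_iff)
  have root: "z \<in> {0, \<i>, - \<i>}" if "z * (z * z) + z = 0" for z :: complex
  proof -
    have "z * ((z - \<i>) * (z + \<i>)) = 0"
      using that by (simp add: algebra_simps)
    then show ?thesis by (auto simp: add_eq_0_iff2)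
  qed
  show "mu1 \<in> {0, \<i>, - \<i>}" "mu2 \<in> {0, \<i>, - \<i>}" "mu3 \<in> {0, \<i>, - \<i>}"
    using * by (simp_all only: root)
  then show imaginary
    by (auto simp: imaginary_def)
qed

text \<open>A zero scalar kills every component: it occurs either as the outer factor or in the
  product. If all are nonzero, take the first component: for \<open>mu2 = - mu3\<close> one has
  \<open>mu2 * mu3 = 1\<close>, so its quadratic factor is 0; for \<open>mu2 = mu3 = - mu1\<close>
  both sums are 0. The others follow cyclically.\<close>

lemma hermitian_or_equal_mu:
  assumes "f_structure f" "\<not> (mu1 = mu2 \<and> mu2 = mu3 \<and> mu1 \<noteq> 0)"
    "X \<in> vector_fields" "Y \<in> vector_fields"
  shows "CT X Y = vf_zero"
  unfolding vf_zero_iff [of "CT X Y", OF CT_tangent [OF assms(3,4)]]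
proof
  fix x assume x: "x \<in> SU3"
  obtain u v w u' v' w' where XY: "frame_field X x = mvec u v w" "frame_field Y x = mvec u' v' w'"
    using frame_field_cases assms(3,4) x by metis
  have "4 *\<^sub>R hat x (CT X Y (proj x)) = mvec 0 0 0"
    unfolding hat_CT_mvec [OF f_structure_mu(4) [OF assms(1)] x assms(3,4) XY]
    using f_structure_mu(1-3) [OF assms(1)] assms(2) by (auto simp: mvec_eq_iff power2_eq_square)
  then show "hat x (CT X Y (proj x)) = 0"
    by (simp add: mvec_zero)
qed

text \<open>At (1,1,1) every product of coordinates is 1. For equal scalars \<i> or -\<i> the
  quadratic factor is -2, so each component is a nonzero multiple of the sum of its two
  coefficients.\<close>

lemma G1f_coefficients:
  assumes "f_structure f" "mu1 = mu2" "mu2 = mu3" "mu1 \<noteq> 0"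
    and G1: "\<forall>X\<in>vector_fields. CT X X = vf_zero"
  shows "c1 + d1 = 0" "c2 + d2 = 0" "c3 + d3 = 0"
proof -
  define X where "X = fundamental_field (mat 1) (mvec 1 1 1)"
  have X: "X \<in> vector_fields" "frame_field X (mat 1) = mvec 1 1 1"
    by (simp_all add: X_def fundamental_field_in_vector_fields frame_field_fundamental_field mat_1_in_SU3)
  have "4 *\<^sub>R hat (mat 1) (CT X X (proj (mat 1))) = mvec 0 0 0"
    using G1 X(1) by (simp add: vf_zero_def hat_linear_simps mvec_zero)
  then have *: "mvec 0 0 0 = mvec
      (mu1 * cnj ((mu1 * mu1 - (mu1 * mu1)\<^sup>2) * (c1 * (mu1 + mu1) * 1 * 1 + d1 * (mu1 + mu1) * 1 * 1)))
      (mu1 * cnj ((mu1 * mu1 - (mu1 * mu1)\<^sup>2) * (c2 * (mu1 + mu1) * 1 * 1 + d2 * (mu1 + mu1) * 1 * 1)))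
      (mu1 * cnj ((mu1 * mu1 - (mu1 * mu1)\<^sup>2) * (c3 * (mu1 + mu1) * 1 * 1 + d3 * (mu1 + mu1) * 1 * 1)))"
    using hat_CT_mvec [OF f_structure_mu(4) [OF assms(1)] mat_1_in_SU3 X(1) X(1) X(2) X(2)]
    unfolding assms(2,3) [symmetric] by simp
  have "mu1 = \<i> \<or> mu1 = - \<i>"
    using f_structure_mu(1) [OF assms(1)] assms(4) by auto
  then have "complex_of_real c1 + d1 = 0" "complex_of_real c2 + d2 = 0" "complex_of_real c3 + d3 = 0"
    using * unfolding mvec_eq_iff
    by (auto simp: power2_eq_square distrib_right [symmetric])
  then show "c1 + d1 = 0" "c2 + d2 = 0" "c3 + d3 = 0"
    by (metis of_real_add of_real_eq_0_iff)+
qed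

text \<open>For equal arguments the two products in each component coincide, so only the sum of the
  coefficients remains.\<close>

lemma cov_diagonal_zero:
  assumes imaginary "mu1 = mu2" "mu2 = mu3" "c1 + d1 = 0" "c2 + d2 = 0" "c3 + d3 = 0"
    and "X \<in> vector_fields"
  shows "cov nabla f X X = vf_zero"
  unfolding vf_zero_iff [of "cov nabla f X X", OF cov_tangent [OF assms(7,7)]]
proof
  fix x assume x: "x \<in> SU3"
  obtain u v w where X: "frame_field X x = mvec u v w"
    by (rule frame_field_cases [OF assms(7) x])
  have d: "d1 = - c1" "d2 = - c2" "d3 = - c3"
    using assms(4-6) by simp_all
  show "hat x (cov nabla f X X (proj x)) = 0"
    unfolding hat_cov_mvec [OF assms(1) x assms(7,7) X X] assms(2,3) d
    by (simp add: mvec_eq_zero_iff)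
qed

lemma G1f_imp_NKf_or_Hf:
  assumes "f_structure f" "G1f_structure g nabla f"
  shows "NKf_structure g nabla f \<or> Hf_structure g nabla f"
proof (cases "mu1 = mu2 \<and> mu2 = mu3 \<and> mu1 \<noteq> 0")
  case True
  then have "c1 + d1 = 0" "c2 + d2 = 0" "c3 + d3 = 0"
    using G1f_coefficients assms unfolding G1f_structure_def by blast+
  then have "\<forall>X\<in>vector_fields. cov nabla f (app f X) (app f X) = vf_zero"
    using True cov_diagonal_zero f_structure_mu(4) [OF assms(1)] app_in_vector_fields by blast
  then show ?thesis
    using assms(2) by (simp add: NKf_structure_def G1f_structure_def)
next
  case False
  then show ?thesis
    using hermitian_or_equal_mu [OF assms(1)] assms(2)
    by (simp add: Hf_structure_def G1f_structure_def)
qed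

section \<open>The classes of almost Hermitian structures\<close>

lemma almost_hermitian_mu:
  assumes "almost_hermitian g f"
  shows "mu1 = \<i> \<or> mu1 = - \<i>" "mu2 = \<i> \<or> mu2 = - \<i>" "mu3 = \<i> \<or> mu3 = - \<i>" imaginary
proof -
  let ?o = "proj (mat 1)" and ?v = "tv (mat 1) (mvec 1 1 1)"
  have v: "?v \<in> tangent_space ?o"
    by (intro tv_in_tangent_space mat_1_in_SU3)
  have "hat (mat 1) (f ?o (f ?o ?v)) = hat (mat 1) (tv_scale (- 1) ?v)"
    using assms v by (simp add: almost_hermitian_def)
  then have "fm (fm (mvec 1 1 1)) = - mvec 1 1 1"
    by (simp add: hat_linear_simps hat_f mat_1_in_SU3 f_tangent v hat_tv)
  then have *: "mu1 * mu1 = - 1" "mu2 * mu2 = - 1" "mu3 * mu3 = - 1"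
    by (simp_all add: fm_mvec mvec_linear_simps mvec_eq_iff)
  have root: "z = \<i> \<or> z = - \<i>" if "z * z = - 1" for z :: complex
  proof -
    have "(z - \<i>) * (z + \<i>) = 0"
      using that by (simp add: algebra_simps)
    then show ?thesis by (auto simp: add_eq_0_iff2)
  qed
  show "mu1 = \<i> \<or> mu1 = - \<i>" "mu2 = \<i> \<or> mu2 = - \<i>" "mu3 = \<i> \<or> mu3 = - \<i>"
    using * by (simp_all only: root)
  then show imaginary
    by (auto simp: imaginary_def)
qed

text \<open>For an almost complex \<open>f\<close> this is the composition tensor up to an
  invertible factor: \<open>f\<close> applied twice changes the sign of both arguments, which
  cancels. Hence \<open>1 - mu2 * mu3\<close> takes the place of the quadratic factor.\<close>

lemma hat_hermitian_defect:
  fixes u v w u' v' w' :: complex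
  assumes imaginary "x \<in> SU3" "X \<in> vector_fields" "Y \<in> vector_fields"
    and XY: "frame_field X x = mvec u v w" "frame_field Y x = mvec u' v' w'"
  shows "hat x (vf_diff (cov nabla f X Y) (cov nabla f (app f X) (app f Y)) (proj x)) = mvec
    (cnj ((1 - mu2 * mu3) * (c1 * (mu1 + mu3) * v * w' + d1 * (mu1 + mu2) * w * v')))
    (cnj ((1 - mu3 * mu1) * (c2 * (mu2 + mu1) * w * u' + d2 * (mu2 + mu3) * u * w')))
    (cnj ((1 - mu1 * mu2) * (c3 * (mu3 + mu2) * u * v' + d3 * (mu3 + mu1) * v * u')))"
proof -
  note f1 = app_in_vector_fields [OF assms(3)] app_in_vector_fields [OF assms(4)]
  note h1 = frame_field_app_mvec [OF assms(3,2) XY(1)] frame_field_app_mvec [OF assms(4,2) XY(2)]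
  show ?thesis
    unfolding vf_diff_def hat_linear_simps hat_cov_mvec [OF assms(1-4) XY]
      hat_cov_mvec [OF assms(1,2) f1 h1]
    by (simp add: mvec_linear_simps mvec_eq_iff) (simp add: algebra_simps)
qed

lemma class_G1_imp_nearly_kaehler_or_hermitian:
  assumes "class_G1 g nabla f"
  shows "nearly_kaehler g nabla f \<or> hermitian g nabla f"
proof -
  have ah: "almost_hermitian g f"
    and G1: "\<forall>X\<in>vector_fields. vf_diff (cov nabla f X X) (cov nabla f (app f X) (app f X)) = vf_zero"
    using assms by (simp_all add: class_G1_def)
  note mu = almost_hermitian_mu [OF ah]
  show ?thesis
  proof (cases "mu1 = mu2 \<and> mu2 = mu3")
    case True
    define X where "X = fundamental_field (mat 1) (mvec 1 1 1)"
    have X: "X \<in> vector_fields" "frame_field X (mat 1) = mvec 1 1 1"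
      by (simp_all add: X_def fundamental_field_in_vector_fields frame_field_fundamental_field mat_1_in_SU3)
    have "hat (mat 1) (vf_diff (cov nabla f X X) (cov nabla f (app f X) (app f X)) (proj (mat 1))) = mvec 0 0 0"
      using G1 X(1) by (simp add: vf_zero_def hat_linear_simps mvec_zero)
    then have *: "mvec 0 0 0 = mvec
        (cnj ((1 - mu1 * mu1) * (c1 * (mu1 + mu1) * 1 * 1 + d1 * (mu1 + mu1) * 1 * 1)))
        (cnj ((1 - mu1 * mu1) * (c2 * (mu1 + mu1) * 1 * 1 + d2 * (mu1 + mu1) * 1 * 1)))
        (cnj ((1 - mu1 * mu1) * (c3 * (mu1 + mu1) * 1 * 1 + d3 * (mu1 + mu1) * 1 * 1)))"
      using hat_hermitian_defect [OF mu(4) mat_1_in_SU3 X(1) X(1) X(2) X(2)] True by simp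
    have "complex_of_real c1 + d1 = 0" "complex_of_real c2 + d2 = 0" "complex_of_real c3 + d3 = 0"
      using * mu(1) unfolding mvec_eq_iff by (auto simp: distrib_right [symmetric])
    then have "c1 + d1 = 0" "c2 + d2 = 0" "c3 + d3 = 0"
      by (metis of_real_add of_real_eq_0_iff)+
    then have "\<forall>X\<in>vector_fields. cov nabla f X X = vf_zero"
      using True cov_diagonal_zero mu(4) by blast
    then show ?thesis
      using ah by (simp add: nearly_kaehler_def)
  next
    case False
    have "vf_diff (cov nabla f X Y) (cov nabla f (app f X) (app f Y)) = vf_zero"
      if X: "X \<in> vector_fields" and Y: "Y \<in> vector_fields" for X Y
    proof -
      let ?V = "vf_diff (cov nabla f X Y) (cov nabla f (app f X) (app f Y))"
      have "?V p \<in> tangent_space p" for p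
        unfolding vf_diff_def
        by (intro tangent_space_closed(2) cov_tangent app_in_vector_fields X Y)
      moreover have "hat x (?V (proj x)) = 0" if x: "x \<in> SU3" for x
      proof -
        obtain u v w u' v' w' where XY: "frame_field X x = mvec u v w" "frame_field Y x = mvec u' v' w'"
          using frame_field_cases X Y x by metis
        show ?thesis
          unfolding hat_hermitian_defect [OF mu(4) x X Y XY]
          \<comment> \<open>In each component either the two scalars of the other planes are
            opposite and their product is 1, or they agree and are opposite to the scalar of its own
            plane, and both sums are 0.\<close>
          using mu(1-3) False by (auto simp: mvec_eq_zero_iff)
      qed
      ultimately show ?thesis
        using vf_zero_iff by blast
    qed
    then show ?thesis
      using ah by (simp add: hermitian_def)
  qed
qed

end

theorem proposition5:
  shows "\<not> (\<exists>f g nabla. f_structure f \<and> invariant_tensor f \<and>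
              riemannian_metric g \<and> invariant_metric g \<and> levi_civita g nabla \<and>
              strictly_G1f_structure g nabla f) \<and>
         (\<forall>f g nabla. f_structure f \<and> invariant_tensor f \<and>
              riemannian_metric g \<and> invariant_metric g \<and> levi_civita g nabla \<and>
              G1f_structure g nabla f \<longrightarrow>
              NKf_structure g nabla f \<or> Hf_structure g nabla f) \<and>
         \<not> (\<exists>J g nabla. almost_hermitian g J \<and> invariant_tensor J \<and>
              invariant_metric g \<and> levi_civita g nabla \<and>
              strictly_G1 g nabla J)"
proof -
  have f: "NKf_structure g nabla f \<or> Hf_structure g nabla f"
    if "f_structure f" "invariant_tensor f" "riemannian_metric g" "invariant_metric g"
      "levi_civita g nabla" "G1f_structure g nabla f" for f g nabla
  proof -
    interpret invariant_data f g nabla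
      using that by unfold_locales (simp_all add: f_structure_def)
    show ?thesis by (rule G1f_imp_NKf_or_Hf [OF that(1,6)])
  qed
  have J: "nearly_kaehler g nabla J \<or> hermitian g nabla J"
    if "almost_hermitian g J" "invariant_tensor J" "invariant_metric g" "levi_civita g nabla"
      "class_G1 g nabla J" for J g nabla
  proof -
    interpret invariant_data J g nabla
      using that by unfold_locales (simp_all add: almost_hermitian_def)
    show ?thesis by (rule class_G1_imp_nearly_kaehler_or_hermitian [OF that(5)])
  qed
  show ?thesis
    unfolding strictly_G1f_structure_def strictly_G1_def using f J by blast
qed

end
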